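(* Let $q$ be an odd prime power with $q\geq 7$. The following is the complete list of normalised permutation polynomials of degree $6$ of $\mathbb{F}_q$; that is, a polynomial $f\in\mathbb{F}_q[x]$ of degree $6$ is a normalised permutation polynomial of $\mathbb{F}_q$ if and only if it is one of the following (in particular $q\in\{9,11,27\}$ whenever one exists): \begin{enumerate} \item $x^6\pm 2x$, $q=11$. \item $x^6\pm 4x$, $q=11$. \item $x^6\pm a^2x^3+ax^2\pm 5x$ (the two signs being equal), $a$ a nonzero square, $q=11$. \item $x^6\pm 4a^2x^3+ax^2\pm 4x$ (the two signs being equal), $a$ not a square, $q=11$. \item $x^6+a^2x^4+a^7bx^3+a^4x^2+a(2b+1)x$, $a\neq 0$, $b\in\{0,1,2^{1/2},1+2^{1/2}\}$, $q=3^2$. \item $x^6+ax^5+2abx^4+(a^3+ab^2+2b^3)x^3+(2a^4+ab^3)x^2+(2a^5+a^4b+2ab^4)x$, $a\neq 0$, $b$ arbitrary, $q=3^2$. \item $x^6+ax^5+2abx^4+(ab^2+2b^3+a^3\varphi)x^3+(ab^3+2a^4\varphi)x^2+(2^{1/2}a^5+2ab^4+a^4b\varphi)x$, $a\neq 0$, $b$ arbitrary, $\varphi=\pm(1-2^{1/2})$, $q=3^2$. \item $x^6+ax^5+2abx^4+(2a^3+ab^2+2b^3)x^3+(a^4+ab^3)x^2+(2a^5+2^{1/2}a^5+2a^4b+2ab^4)x$, $a\neq 0$, $b$ arbitrary, $q=3^2$. \item $x^6+ax^5+2abx^4+(ab^2+2b^3)x^3+(2a^4+ab^3)x^2+(a^4b+2ab^4)x$,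 $a\neq 0$, $b$ arbitrary, $q=3^3$. \end{enumerate} Here $a,b$ range over elements of $\mathbb{F}_q$ subject to the stated restrictions.
   Context: A polynomial $f\in\mathbb{F}_q[x]$ is a permutation polynomial of $\mathbb{F}_q$ if $c\mapsto f(c)$ is a permutation of $\mathbb{F}_q$. A permutation polynomial $f\in\mathbb{F}_q[x]$ is of normalised form if $f$ is monic, $f(0)=0$, and, when the degree $n$ of $f$ is not divisible by the characteristic of $\mathbb{F}_q$, the coefficient of $x^{n-1}$ is zero. The symbol $2^{1/2}$ stands for either root of $x^2-2$ in $\mathbb{F}_{3^2}$: both choices are allowed, but within any single polynomial all occurrences of $2^{1/2}$ (including those in $\varphi$) denote the same root. *)

theory Defs
  imports
    "HOL-Library.Cardinality"
    "HOL-Computational_Algebra.Computational_Algebra"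
    "HOL-Number_Theory.Prime_Powers"
begin

definition permutation_poly :: "'a :: finite_field poly \<Rightarrow> bool" where
  "permutation_poly f \<longleftrightarrow> bij (poly f)"

(* If degree f = 0, the third condition is vacuous because CHAR('a) divides 0. *)
definition normalised_poly :: "'a :: finite_field poly \<Rightarrow> bool" where
  "normalised_poly f \<longleftrightarrow>
     lead_coeff f = 1 \<and> poly f 0 = 0 \<and>
     (\<not> CHAR('a) dvd degree f \<longrightarrow> coeff f (degree f - 1) = 0)"

end

(* The heart is Hermite's criterion: if f permutes the field and q - 1 <= 6 N < 2 (q - 1), then the
   coefficient of x^(q-1) in f^N vanishes. For q = 1 (mod 6), N = (q - 1)/6 is already contradictory.
   For q = 5 (mod 6), N = (q + 1)/6 + j with j = 0, 1, 2, 3 gives equations which exclude all f unless the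
   characteristic is 2, 3 or 1 (mod 6); for q = 17 and q = 11 some of these exponents are too large.
   In characteristic 3 the exponents are chosen by their ternary digits, so that Frobenius splits f^N
   into small powers. Apart from q = 9 and q = 27 they force f either to be quadratic in the additive
   polynomial x^3 - b x or, after an affine change of variable, to be the square of x (x + 1)^2.
   The remaining cases q = 9, 11, 27 are finite and are evaluated in explicit models of the fields. *)

theory Submission
  imports Defs
begin

section \<open>Hermite's criterion\<close>

text \<open>Reversing f turns the coefficient of x^(q-1) in f^N into that of x^D in a power of a
  polynomial with constant term 1, where D = 6 N - (q - 1). If D is fixed and 6 is invertible, the
  resulting equation is the same for all q: N occurs only in binomial coefficients, and in the field
  it equals j + 1/6. In characteristic 3 this breaks down, and translations cannot touch the
  coefficient of x^5. If that coefficient is nonzero, a translation removes x^4 instead, which leads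
  to \<open>sextic 1 0 c d e\<close>. The conditions with bounded D that are used there still leave
  the family d = - c - 1, e = c - 1 with c free. It takes an exponent whose D grows with q to fix c.
  The coefficient that arises obeys a recursion over the ternary digits and is a power of 1 - c, so
  that c = 1 remains.\<close>

lemma finite_field_power_minus_1:
  fixes x :: "'a :: finite_field"
  assumes "x \<noteq> 0"
  shows "x ^ (CARD('a) - 1) = 1"
proof -
  have "x * x ^ (CARD('a) - 1) = x"
    using finite_field_power_card_eq_same[of x]
    by (metis One_nat_def Suc_pred finite_UNIV_card_ge_0 finite power_Suc)
  with assms show ?thesis by simp
qed

lemma exists_power_neq_1:
  assumes "0 < j" "j < CARD('a :: finite_field) - 1"
  obtains y :: "'a :: finite_field" where "y \<noteq> 0" "y ^ j \<noteq> 1"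
proof -
  let ?p = "monom 1 j - 1 :: 'a poly"
  have deg: "degree ?p = j"
    using assms(1) degree_add_eq_left[of "- 1" "monom 1 j :: 'a poly"]
    by (simp add: degree_monom_eq)
  hence "?p \<noteq> 0" using assms(1) by force
  hence "card {x. poly ?p x = 0} \<le> j"
    using card_poly_roots_bound[of ?p] deg by simp
  also have "j < card (UNIV - {0 :: 'a})"
    using assms by (simp add: card_Diff_singleton)
  finally have "\<not> UNIV - {0} \<subseteq> {x. poly ?p x = 0}"
    by (meson card_mono finite_code not_le)
  thus ?thesis using that by (auto simp: poly_monom)
qed

text \<open>Replacing \<open>x\<close> by \<open>y * x\<close> permutes the field and multiplies the
  sum by \<open>y ^ j\<close>, which differs from 1 for a suitable \<open>y\<close>.\<close>

lemma sum_power_eq_0: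
  assumes "0 < j" "j < CARD('a :: finite_field) - 1"
  shows "(\<Sum>x\<in>UNIV. x ^ j) = (0 :: 'a :: finite_field)"
proof -
  obtain y :: 'a where y: "y \<noteq> 0" "y ^ j \<noteq> 1"
    using exists_power_neq_1 assms by blast
  have "(\<Sum>x\<in>UNIV. x ^ j) = (\<Sum>x\<in>UNIV. (y * x) ^ j)"
    by (rule sum.reindex_bij_witness[of _ "\<lambda>x. y * x" "\<lambda>x. x / y"]) (use y in auto)
  also have "\<dots> = y ^ j * (\<Sum>x\<in>UNIV. x ^ j)"
    by (simp add: power_mult_distrib sum_distrib_left)
  finally have "(1 - y ^ j) * (\<Sum>x\<in>UNIV. x ^ j) = 0"
    by (simp add: algebra_simps)
  with y show ?thesis by simp
qed

text \<open>Shifting the summation variable by 1 leaves the sum of all elements unchanged, yet adds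
  1 once per element.\<close>

lemma of_nat_CARD_eq_0: "of_nat CARD('a :: finite_field) = (0 :: 'a :: finite_field)"
proof -
  have "(\<Sum>x\<in>UNIV. x) = (\<Sum>x\<in>UNIV. x + 1 :: 'a)"
    by (rule sum.reindex_bij_witness[of _ "\<lambda>x. x + 1" "\<lambda>x. x - 1"]) auto
  thus ?thesis by (simp add: sum.distrib)
qed

lemma CHAR_eq_prime_base:
  assumes "CARD('a :: finite_field) = p ^ k" "prime p"
  shows "CHAR('a) = p"
proof -
  have "of_nat (p ^ k) = (0 :: 'a)" using of_nat_CARD_eq_0[where 'a = 'a] by (simp only: assms)
  hence "CHAR('a) dvd p ^ k" by (simp only: of_nat_eq_0_iff_char_dvd)
  hence "CHAR('a) dvd p" using prime_dvd_power[OF CHAR_prime] by blast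
  thus ?thesis using assms(2) by (metis CHAR_prime primes_dvd_imp_eq)
qed

lemma sum_power_CARD_minus_1:
  "(\<Sum>x\<in>UNIV. x ^ (CARD('a :: finite_field) - 1)) = (- 1 :: 'a :: finite_field)"
proof -
  have C: "CARD('a) > 1"
    using card_mono[of "UNIV :: 'a set" "{0, 1}"] by simp
  have "(\<Sum>x\<in>UNIV. x ^ (CARD('a) - 1)) = (\<Sum>x\<in>UNIV - {0 :: 'a}. 1 :: 'a)"
    by (rule sum.mono_neutral_cong_right)
       (use C in \<open>auto simp: finite_field_power_minus_1 zero_power simp del: One_nat_def\<close>)
  also have "\<dots> = of_nat CARD('a) - 1"
    using C by (simp add: card_Diff_singleton of_nat_diff)
  finally show ?thesis by (simp add: of_nat_CARD_eq_0)
qed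

text \<open>Power sums over the field vanish unless the exponent is a positive multiple of q - 1;
  the degree bound leaves q - 1 as the only such exponent.\<close>

lemma sum_poly_eq_minus_coeff:
  fixes p :: "'a :: finite_field poly"
  assumes "degree p < 2 * (CARD('a) - 1)"
  shows "(\<Sum>x\<in>UNIV. poly p x) = - coeff p (CARD('a) - 1)"
proof -
  let ?m = "CARD('a) - 1"
  have C: "CARD('a) > 1"
    using card_mono[of "UNIV :: 'a set" "{0, 1}"] by simp
  have S: "(\<Sum>x\<in>UNIV. x ^ i) = (if i = ?m then - 1 else 0 :: 'a)" if "i < 2 * ?m" for i
  proof -
    consider "i = 0" | "0 < i" "i < ?m" | "i = ?m" | "?m < i" by linarith
    thus ?thesis
    proof cases
      \<comment> \<open>\<open>x ^ 0\<close> is 1 at \<open>x = 0\<close> as well, so the sum counts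
        all q elements and vanishes.\<close>
      case 1
      thus ?thesis using C by (simp add: of_nat_CARD_eq_0)
    next
      case 2
      thus ?thesis by (simp add: sum_power_eq_0)
    next
      case 3
      thus ?thesis by (simp add: sum_power_CARD_minus_1 del: One_nat_def)
    next
      case 4
      define j where "j = i - ?m"
      have "x ^ i = x ^ j" for x :: 'a
      proof (cases "x = 0")
        case False
        have "i = j + ?m" using 4 by (simp add: j_def)
        thus ?thesis
          using finite_field_power_minus_1[OF False] by (simp add: power_add del: One_nat_def)
      qed (use 4 in \<open>auto simp: j_def zero_power\<close>)
      moreover have "0 < j" "j < ?m" using 4 that by (auto simp: j_def)
      ultimately show ?thesis using 4 by (simp add: sum_power_eq_0)
    qed
  qed
  have "(\<Sum>x\<in>UNIV. poly p x) = (\<Sum>x\<in>UNIV. \<Sum>i<2 * ?m. coeff p i * x ^ i)"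
    unfolding poly_altdef
    by (intro sum.cong sum.mono_neutral_left refl)
       (use assms in \<open>auto simp: coeff_eq_0 not_le\<close>)
  also have "\<dots> = (\<Sum>i<2 * ?m. coeff p i * (\<Sum>x\<in>UNIV. x ^ i))"
    by (subst sum.swap) (simp add: sum_distrib_left)
  also have "\<dots> = (\<Sum>i<2 * ?m. if i = ?m then - coeff p i else 0)"
    by (intro sum.cong refl) (simp add: S)
  also have "\<dots> = - coeff p ?m"
    using C by simp
  finally show ?thesis .
qed

text \<open>A permutation of the field preserves the sum of all N-th powers, which is 0; computed
  through the polynomial \<open>p ^ N\<close>, the same sum is minus one coefficient.\<close>

lemma hermite_criterion:
  fixes p :: "'a :: finite_field poly"
  assumes "inj (poly p)" "0 < N" "N < CARD('a) - 1"
    and "degree p * N < 2 * (CARD('a) - 1)"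
  shows "coeff (p ^ N) (CARD('a) - 1) = 0"
proof -
  have "degree (p ^ N) < 2 * (CARD('a) - 1)"
    using degree_power_le[of p N] assms(4) by linarith
  hence "- coeff (p ^ N) (CARD('a) - 1) = (\<Sum>x\<in>UNIV. poly (p ^ N) x)"
    by (simp only: sum_poly_eq_minus_coeff)
  also have "\<dots> = (\<Sum>x\<in>UNIV. poly p x ^ N)" by simp
  also have "\<dots> = (\<Sum>x\<in>UNIV. x ^ N)"
    using assms(1) finite_UNIV_inj_surj[of "poly p"]
    by (intro sum.reindex_bij_betw bij_betw_imageI) auto
  also have "\<dots> = 0" using assms by (simp add: sum_power_eq_0)
  finally show ?thesis by simp
qed

text \<open>Powers of the reversed polynomial have their relevant coefficients near the bottom.\<close>
lemma hermite_criterion_reflect: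
  fixes p :: "'a :: finite_field poly"
  assumes "inj (poly p)" "0 < N" "N < CARD('a) - 1"
    and "degree p * N < 2 * (CARD('a) - 1)" "degree p * N = CARD('a) - 1 + D"
  shows "coeff (reflect_poly p ^ N) D = 0"
proof -
  have "p \<noteq> 0" "D \<le> CARD('a) - 1 + D" using assms(2,3,5) by auto
  hence "coeff (reflect_poly (p ^ N)) D = coeff (p ^ N) (CARD('a) - 1)"
    using assms(5) by (simp add: coeff_reflect_poly degree_power_eq mult.commute del: One_nat_def)
  thus ?thesis
    using hermite_criterion[OF assms(1-4)] by (simp add: reflect_poly_power)
qed

text \<open>The arguments descend from the coefficient of x^5. In the reversed polynomial they
  follow the constant term 1, so that the i-th argument has weight i when x is scaled.\<close>

definition sextic :: "'a \<Rightarrow> 'a \<Rightarrow> 'a \<Rightarrow> 'a \<Rightarrow> 'a \<Rightarrow> 'a :: comm_ring_1 poly" where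
  "sextic a b c d e = [:0, e, d, c, b, a, 1:]"

lemma degree_sextic [simp]: "degree (sextic a b c d e) = 6"
  by (simp add: sextic_def)

lemma reflect_sextic: "reflect_poly (sextic a b c d e) = [:1, a, b, c, d, e:]"
  by (auto simp: sextic_def reflect_poly_def poly_eq_iff cCons_def)

lemma poly_sextic:
  "poly (sextic a b c d e) x = x^6 + a * x^5 + b * x^4 + c * x^3 + d * x^2 + e * x"
  by (simp add: sextic_def algebra_simps power_def numeral_eq_Suc)

lemma hermite_sextic:
  fixes a b c d e :: "'a :: finite_field"
  assumes "inj (poly (sextic a b c d e))" "0 < N"
    and "6 * N < 2 * (CARD('a) - 1)" "6 * N = CARD('a) - 1 + D"
  shows "coeff ([:1, a, b, c, d, e:] ^ N) D = 0"
  using hermite_criterion_reflect[of "sextic a b c d e" N D] assms by (simp add: reflect_sextic)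

section \<open>Coefficients in high powers\<close>

lemma sum_atMost_numeral: "(\<Sum>i\<le>(numeral n :: nat). f i) = (\<Sum>i\<le>pred_numeral n. f i) + f (numeral n)"
  by (simp add: numeral_eq_Suc)

text \<open>The i-th binomial term starts at x^(k i), so the range depends on \<open>D\<close> and
  \<open>k\<close> only. The exponent \<open>N\<close>, which grows with the field, survives just in
  the binomial coefficients.\<close>

lemma coeff_one_plus_power:
  fixes h :: "'a :: comm_semiring_1 poly"
  assumes "k > 0"
  shows "coeff ((1 + monom 1 k * h) ^ N) D =
    (\<Sum>i\<le>D div k. of_nat (N choose i) * coeff (h ^ i) (D - k * i))"
proof -
  have "coeff ((1 + monom 1 k * h) ^ N) D =
      (\<Sum>i\<le>N. coeff (of_nat (N choose i) * (monom 1 (k * i) * h ^ i)) D)"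
    by (subst add.commute, subst binomial_ring)
       (simp add: coeff_sum power_mult_distrib monom_power mult_ac)
  also have "\<dots> = (\<Sum>i\<le>N. if k * i \<le> D then of_nat (N choose i) * coeff (h ^ i) (D - k * i) else 0)"
    by (intro sum.cong refl)
       (simp add: of_nat_poly smult_monom_mult coeff_monom_mult)
  \<comment> \<open>Either of \<open>N\<close> and \<open>D div k\<close> may be the larger one; a
    range containing both lets each side be compared by dropping zero terms.\<close>
  also have "\<dots> = (\<Sum>i\<le>N + D div k. if k * i \<le> D then of_nat (N choose i) * coeff (h ^ i) (D - k * i) else 0)"
    by (rule sum.mono_neutral_left) (auto simp: binomial_eq_0)
  also have "\<dots> = (\<Sum>i\<le>D div k. of_nat (N choose i) * coeff (h ^ i) (D - k * i))"
    by (rule sum.mono_neutral_cong_right)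
       (use assms in \<open>auto simp: less_eq_div_iff_mult_less_eq mult.commute\<close>)
  finally show ?thesis .
qed

text \<open>By Frobenius, \<open>q ^ m\<close> has nonzero coefficients only at multiples of
  \<open>m\<close>, where they are the m-th powers of those of \<open>q\<close>.\<close>

lemma coeff_mult_frobenius:
  fixes p q :: "'a :: comm_ring_1 poly"
  assumes "prime CHAR('a)" "m = CHAR('a) ^ k"
  shows "coeff (p * q ^ m) n = (\<Sum>j\<le>n div m. coeff p (n - m * j) * coeff q j ^ m)"
proof -
  have m: "m > 0" using assms by (simp add: prime_gt_0_nat)
  have C: "coeff (p * monom c i) n = (if i \<le> n then coeff p (n - i) * c else 0)" for c i
    using coeff_monom_mult[of c i p n] by (auto simp: mult.commute)
  have "q ^ m = (\<Sum>i\<le>degree q. monom (coeff q i) i) ^ m"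
    by (simp add: poly_as_sum_of_monoms)
  also have "\<dots> = (\<Sum>i\<le>degree q. monom (coeff q i) i ^ m)"
    by (rule freshmans_dream_sum'[where n = k]) (use assms in auto)
  also have "\<dots> = (\<Sum>i\<le>degree q. monom (coeff q i ^ m) (m * i))"
    by (simp add: monom_power mult.commute)
  finally have "coeff (p * q ^ m) n =
      (\<Sum>i\<le>degree q. if m * i \<le> n then coeff p (n - m * i) * coeff q i ^ m else 0)"
    by (simp add: sum_distrib_left coeff_sum C)
  also have "\<dots> = (\<Sum>j\<le>degree q + n div m.
      if m * j \<le> n then coeff p (n - m * j) * coeff q j ^ m else 0)"
    by (rule sum.mono_neutral_left) (use m in \<open>auto simp: coeff_eq_0 zero_power\<close>)
  also have "\<dots> = (\<Sum>j\<le>n div m. coeff p (n - m * j) * coeff q j ^ m)"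
    by (rule sum.mono_neutral_cong_right)
       (use m in \<open>auto simp: less_eq_div_iff_mult_less_eq mult.commute\<close>)
  finally show ?thesis .
qed

section \<open>Fields with \<open>q \<equiv> 5 (mod 6)\<close>\<close>

text \<open>Without division the ratio of neighbouring binomials makes sense in the field, where it
  depends on the image of \<open>N\<close> alone.\<close>

lemma of_nat_choose_Suc:
  "of_nat (Suc i) * of_nat (N choose Suc i) =
    (of_nat N - of_nat i) * (of_nat (N choose i) :: 'a :: comm_ring_1)"
proof (cases "i \<le> N")
  case True
  have "Suc i * (N choose Suc i) = (N - i) * (N choose i)"
    by (metis binomial_absorb_comp binomial_absorption mult.commute)
  hence "of_nat (Suc i) * of_nat (N choose Suc i) = (of_nat (N - i) * of_nat (N choose i) :: 'a)"
    by (metis of_nat_mult)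
  with True show ?thesis by (simp add: of_nat_diff)
qed (simp add: binomial_eq_0)

text \<open>The pairs of exponent i and index n are those with n = 6 j + 2 - 3 i and n \<le> 2 i for
  j = 1, 2, 3: the surviving terms for the distances 8, 14 and 20.\<close>

lemma coeff_quadratic_power:
  fixes b c d :: "'a :: comm_ring_1"
  shows "coeff ([:b, c, d:] ^ 2) 2 = 2 * b * d + c^2"
    and "coeff ([:b, c, d:] ^ 3) 5 = 3 * c * d^2"
    and "coeff ([:b, c, d:] ^ 4) 2 = 4 * b^3 * d + 6 * b^2 * c^2"
    and "coeff ([:b, c, d:] ^ 4) 8 = d^4"
    and "coeff ([:b, c, d:] ^ 5) 5 = c^5 + 20 * b * c^3 * d + 30 * b^2 * c * d^2"
    and "coeff ([:b, c, d:] ^ 6) 2 = 6 * b^5 * d + 15 * b^4 * c^2"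
  by (simp_all add: numeral_eq_Suc algebra_simps)

lemma coeff_quadratic_power_eq_0:
  fixes b c d :: "'a :: comm_ring_1"
  assumes "2 * i < n"
  shows "coeff ([:b, c, d:] ^ i) n = 0"
proof -
  have "degree ([:b, c, d:] ^ i) \<le> 2 * i"
    by (rule order.trans[OF degree_power_le]) (simp)
  thus ?thesis using assms by (intro coeff_eq_0) simp
qed

text \<open>Here \<open>6 * j + 2\<close> is the distance of the exponent \<open>q - 1\<close> from the degree \<open>6 * N\<close>.\<close>
lemma hermite_drop:
  fixes b c d :: "'a :: finite_field"
  assumes inj: "inj (poly (sextic 0 0 b c d))"
    and N: "6 * N = CARD('a) + 1 + 6 * j" "CARD('a) > 3 + 6 * j"
  shows "(\<Sum>i\<le>(6 * j + 2) div 3. of_nat (N choose i) * coeff ([:b, c, d:] ^ i) (6 * j + 2 - 3 * i)) = 0"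
proof -
  have "[:1, 0, 0, b, c, d:] = 1 + monom 1 3 * [:b, c, d:]"
    by (simp add: monom_altdef numeral_eq_Suc one_pCons)
  moreover have "coeff ([:1, 0, 0, b, c, d:] ^ N) (6 * j + 2) = 0"
    by (rule hermite_sextic[OF inj]) (use N in auto)
  ultimately have "coeff ((1 + monom 1 3 * [:b, c, d:]) ^ N) (6 * j + 2) = 0"
    by (simp only:)
  thus ?thesis by (subst (asm) coeff_one_plus_power) simp_all
qed

text \<open>At distance 2 only \<open>of_nat N * a\<close> is left, and \<open>N\<close> is
  invertible because 6 N = q + 1 is 1 in the field.\<close>

lemma hermite_drop_2:
  fixes a b c d :: "'a :: finite_field"
  assumes inj: "inj (poly (sextic 0 a b c d))"
    and N: "6 * N = CARD('a) + 1" "CARD('a) > 3"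
  shows "a = 0"
proof -
  have "[:1, 0, a, b, c, d:] = 1 + monom 1 2 * [:a, b, c, d:]"
    by (simp add: monom_altdef numeral_eq_Suc one_pCons)
  moreover have "coeff ([:1, 0, a, b, c, d:] ^ N) 2 = 0"
    by (rule hermite_sextic[OF inj]) (use N in auto)
  ultimately have "coeff ((1 + monom 1 2 * [:a, b, c, d:]) ^ N) 2 = 0"
    by (simp only:)
  hence "of_nat N * a = 0"
    by (subst (asm) coeff_one_plus_power) simp_all
  moreover have "of_nat (6 * N) = (of_nat (CARD('a) + 1) :: 'a)" by (simp only: N)
  hence "6 * of_nat N = (1 :: 'a)" by (simp add: of_nat_CARD_eq_0)
  ultimately show ?thesis by auto
qed

text \<open>As q is 0 in the field, 6 N becomes 6 j + 1. The binomials are formally those of j +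
  1/6, and the factor 6 clears the fractions.\<close>

lemma choose_step:
  fixes b c d :: "'a :: finite_field"
  assumes "6 * N = CARD('a) + 1 + 6 * j"
  shows "(of_nat (6 * Suc i) * of_nat (N choose Suc i) :: 'a) =
    (6 * of_nat j + 1 - 6 * of_nat i) * of_nat (N choose i)"
proof -
  have "of_nat (6 * N) = (of_nat (CARD('a) + 1 + 6 * j) :: 'a)" by (simp only: assms)
  hence n: "6 * of_nat N = (6 * of_nat j + 1 :: 'a)" by (simp add: of_nat_CARD_eq_0)
  have "(of_nat (6 * Suc i) * of_nat (N choose Suc i) :: 'a) =
      6 * (of_nat (Suc i) * of_nat (N choose Suc i))"
    by (simp add: algebra_simps)
  also have "\<dots> = (6 * of_nat N - 6 * of_nat i) * of_nat (N choose i)"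
    by (simp only: of_nat_choose_Suc) (simp add: algebra_simps)
  finally show ?thesis by (simp only: n)
qed

lemma hermite_drop_8:
  fixes b c d :: "'a :: finite_field"
  assumes inj: "inj (poly (sextic 0 0 b c d))"
    and N: "6 * N = CARD('a) + 1 + 6 * 1" "CARD('a) > 3 + 6 * 1"
    and "(7 :: 'a) \<noteq> 0"
  shows "c^2 + 2 * b * d = 0"
proof -
  define C where "C = (\<lambda>i. of_nat (N choose i) :: 'a)"
  have C: "C 0 = 1" "6 * C 1 = 7 * C 0" "12 * C 2 = C 1"
    using choose_step[OF N(1), of 0] choose_step[OF N(1), of 1]
    by (simp_all add: C_def eval_nat_numeral)
  \<comment> \<open>Formally \<open>C 2\<close> is (7/6) (1/6) / 2; this is why 7 has to be
    nonzero.\<close>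
  have "72 * C 2 = 7" using C by algebra
  with assms(4) have "C 2 \<noteq> 0" by auto
  moreover have "C 2 * (2 * b * d + c^2) = 0"
    using hermite_drop[OF inj N]
    by (simp add: sum_atMost_numeral coeff_quadratic_power coeff_quadratic_power_eq_0 C_def)
  ultimately show ?thesis by (simp add: add.commute)
qed

lemma hermite_drop_14:
  fixes b c d :: "'a :: finite_field"
  assumes inj: "inj (poly (sextic 0 0 b c d))"
    and N: "6 * N = CARD('a) + 1 + 6 * 2" "CARD('a) > 3 + 6 * 2"
    and nz: "(2 :: 'a) \<noteq> 0" "(7 :: 'a) \<noteq> 0" "(13 :: 'a) \<noteq> 0"
    and "c^2 + 2 * b * d = 0"
  shows "d * (5 * b^3 + 9 * c * d) = 0"
proof -
  define C where "C = (\<lambda>i. of_nat (N choose i) :: 'a)"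
  have C: "C 0 = 1" "6 * C 1 = 13 * C 0" "12 * C 2 = 7 * C 1" "18 * C 3 = C 2" "24 * C 4 = - 5 * C 3"
    using choose_step[OF N(1), of 0] choose_step[OF N(1), of 1]
      choose_step[OF N(1), of 2] choose_step[OF N(1), of 3]
    by (simp_all add: C_def eval_nat_numeral)
  have "6 * 12 * 18 * C 3 = 13 * 7" using C by algebra
  moreover have "(13 :: 'a) * 7 \<noteq> 0" using nz by (simp only: mult_eq_0_iff) simp
  ultimately have "C 3 \<noteq> 0" by (metis mult_zero_right)
  moreover have "C 3 * (3 * c * d^2) + C 4 * (4 * b^3 * d + 6 * b^2 * c^2) = 0"
    using hermite_drop[OF inj N]
    by (simp add: sum_atMost_numeral coeff_quadratic_power coeff_quadratic_power_eq_0 C_def)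
  hence "C 3 * (72 * c * d^2 - 5 * (4 * b^3 * d + 6 * b^2 * c^2)) = 0"
    using C(5) by algebra
  ultimately have "72 * c * d^2 - 5 * (4 * b^3 * d + 6 * b^2 * c^2) = 0" by simp
  \<comment> \<open>Substituting c^2 = - 2 b d turns b^2 c^2 into a multiple of b^3 d. The common
    factor 8 is split because only 2 is known to be nonzero.\<close>
  hence "2 * (2 * (2 * (d * (5 * b^3 + 9 * c * d)))) = 0"
    using assms(7) by algebra
  with nz(1) show ?thesis by (metis mult_eq_0_iff)
qed

text \<open>Formally \<open>C 5\<close> is - 1/6 and \<open>C 6\<close> is 11/216 times
  \<open>C 4\<close>. In characteristic 5 the relation for \<open>C 5\<close> is void, whereas the
  case b = c = 0 involves \<open>C 4\<close> alone.\<close>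

lemma hermite_drop_20:
  fixes b c d :: "'a :: finite_field"
  assumes inj: "inj (poly (sextic 0 0 b c d))"
    and N: "6 * N = CARD('a) + 1 + 6 * 3" "CARD('a) > 3 + 6 * 3"
    and nz: "(7 :: 'a) \<noteq> 0" "(13 :: 'a) \<noteq> 0" "(19 :: 'a) \<noteq> 0"
  shows "b = 0 \<Longrightarrow> c = 0 \<Longrightarrow> d = 0"
    and "(5 :: 'a) \<noteq> 0 \<Longrightarrow> 216 * d^4 - 36 * (c^5 + 20 * b * c^3 * d + 30 * b^2 * c * d^2)
           + 11 * (6 * b^5 * d + 15 * b^4 * c^2) = 0"
proof -
  define C where "C = (\<lambda>i. of_nat (N choose i) :: 'a)"
  have C: "C 0 = 1" "6 * C 1 = 19 * C 0" "12 * C 2 = 13 * C 1" "18 * C 3 = 7 * C 2"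
      "24 * C 4 = C 3" "30 * C 5 = - 5 * C 4" "36 * C 6 = - 11 * C 5"
    using choose_step[OF N(1), of 0] choose_step[OF N(1), of 1] choose_step[OF N(1), of 2]
      choose_step[OF N(1), of 3] choose_step[OF N(1), of 4] choose_step[OF N(1), of 5]
    by (simp_all add: C_def eval_nat_numeral)
  have "6 * 12 * 18 * 24 * C 4 = 19 * 13 * 7" using C by algebra
  moreover have "(19 :: 'a) * 13 * 7 \<noteq> 0" using nz by (simp only: mult_eq_0_iff) simp
  ultimately have C4: "C 4 \<noteq> 0" by (metis mult_zero_right)
  have S: "C 4 * d^4 + C 5 * (c^5 + 20 * b * c^3 * d + 30 * b^2 * c * d^2)
      + C 6 * (6 * b^5 * d + 15 * b^4 * c^2) = 0"
    using hermite_drop[OF inj N]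
    by (simp add: sum_atMost_numeral coeff_quadratic_power coeff_quadratic_power_eq_0 C_def)
  show "d = 0" if "b = 0" "c = 0"
    using S C4 that by simp
  show "216 * d^4 - 36 * (c^5 + 20 * b * c^3 * d + 30 * b^2 * c * d^2)
           + 11 * (6 * b^5 * d + 15 * b^4 * c^2) = 0" if "(5 :: 'a) \<noteq> 0"
  proof -
    have "5 * (6 * C 5 + C 4) = 0" using C(6) by algebra
    with that have "6 * C 5 + C 4 = 0" by (metis mult_eq_0_iff)
    hence "C 4 * (216 * d^4 - 36 * (c^5 + 20 * b * c^3 * d + 30 * b^2 * c * d^2)
           + 11 * (6 * b^5 * d + 15 * b^4 * c^2)) = 0"
      using S C(7) by algebra
    with C4 show ?thesis by simp
  qed
qed

text \<open>With b, c, d of weights 3, 4, 5 both equations are homogeneous and have a single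
  solution up to scaling. The scale is t = c / b, with b = 9/10 t^3, c = 9/10 t^4, d = - 9/20 t^5.
  If 5 were 0, the second equation would force c d = 0.\<close>

lemma sextic_family:
  fixes b c d :: "'a :: field"
  assumes eqs: "c^2 + 2 * b * d = 0" "5 * b^3 + 9 * c * d = 0" and "d \<noteq> 0" "c \<noteq> 0"
    and nz: "(2 :: 'a) \<noteq> 0" "(3 :: 'a) \<noteq> 0"
  obtains t where "t \<noteq> 0" "(5 :: 'a) \<noteq> 0" "20 * b = 18 * t^3" "20 * c = 18 * t^4" "20 * d = - (9 * t^5)"
proof -
  define t where "t = c / b"
  have b: "b \<noteq> 0" using eqs(1) assms by auto
  have c: "c = t * b" and t: "t \<noteq> 0" using b assms by (auto simp: t_def)
  have "(9 :: 'a) \<noteq> 0" 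
    using nz(2) mult_eq_0_iff[of "3 :: 'a" 3] by simp
  hence "(5 :: 'a) \<noteq> 0" using eqs(2) assms by auto
  have "b * (2 * d + t^2 * b) = 0" using eqs(1) c by algebra
  with b have d: "2 * d = - (t^2 * b)" by (simp add: add_eq_0_iff)
  have "b^2 * (10 * b - 9 * t^3) = 0" using eqs(2) c d by algebra
  with b have b': "10 * b = 9 * t^3" by simp
  show ?thesis
  proof (rule that[OF t \<open>5 \<noteq> 0\<close>])
    show "20 * b = 18 * t^3" using b' by algebra
    show "20 * c = 18 * t^4" using b' c by algebra
    show "20 * d = - (9 * t^5)" using b' d by algebra
  qed
qed

text \<open>Serves to invert 2, 3, 7, 13, 19 and 313, none of which is 5 modulo 6.\<close>

lemma numeral_prime_neq_0:
  assumes "CHAR('a :: finite_field) mod 6 = 5" "prime r" "r mod 6 \<noteq> 5"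
  shows "of_nat r \<noteq> (0 :: 'a)"
proof
  assume "of_nat r = (0 :: 'a)"
  hence "CHAR('a) dvd r" by (simp add: of_nat_eq_0_iff_char_dvd)
  with assms(2) have "CHAR('a) = r"
    by (metis CHAR_prime primes_dvd_imp_eq)
  with assms show False by simp
qed

text \<open>The hypothesis says that \<open>m\<close> inverts \<open>k\<close> modulo q - 1, which
  makes \<open>z ^ m\<close> an explicit k-th root of \<open>z\<close>.\<close>

lemma power_bij_solve:
  fixes z :: "'a :: finite_field"
  assumes "k * m = l * (CARD('a) - 1) + 1"
  shows "(z ^ m) ^ k = z"
proof (cases "z = 0")
  case True
  have "m \<noteq> 0" "k \<noteq> 0" using assms by (auto intro: gr0I)
  with True show ?thesis by (simp add: zero_power)
next
  case False
  have "(z ^ m) ^ k = z ^ (l * (CARD('a) - 1) + 1)"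
    by (simp only: power_mult[symmetric] mult.commute[of m] assms)
  also have "\<dots> = (z ^ (CARD('a) - 1)) ^ l * z"
    by (simp only: power_add power_mult mult.commute[of l] power_one_right)
  finally show ?thesis
    by (simp only: finite_field_power_minus_1[OF False]) simp
qed

text \<open>Cubing is bijective, so \<open>x^3 (x^3 + b)\<close> has a nonzero root unless \<open>b = 0\<close>.\<close>
lemma not_inj_sextic_b:
  fixes b :: "'a :: finite_field"
  assumes "CARD('a) mod 6 = 5"
  shows "\<not> inj (poly (sextic 0 0 b 0 0))"
proof
  assume inj: "inj (poly (sextic 0 0 b 0 0))"
  \<comment> \<open>The inverse of 3 modulo q - 1: for q = 6 t + 5, 3 (4 t + 3) = 2 (q - 1) +
    1.\<close>
  define m where "m = 4 * (CARD('a) div 6) + 3"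
  have "CARD('a) = 6 * (CARD('a) div 6) + 5" using assms by presburger
  hence "3 * m = 2 * (CARD('a) - 1) + 1" by (simp add: m_def)
  hence "((- b) ^ m) ^ 3 = - b" by (rule power_bij_solve)
  hence y: "((- b) ^ m) ^ 3 + b = 0" by simp
  have "poly (sextic 0 0 b 0 0) x = x ^ 3 * (x ^ 3 + b)" for x
    by (simp add: poly_sextic algebra_simps power_add[symmetric])
  with y have "poly (sextic 0 0 b 0 0) ((- b) ^ m) = poly (sextic 0 0 b 0 0) 0" by simp
  with inj have "(- b) ^ m = 0" by (simp only: inj_eq)
  with y have b: "b = 0" by simp
  have "poly (sextic 0 0 b 0 0) 1 = poly (sextic 0 0 b 0 0) (- 1)"
    by (simp add: poly_sextic b)
  with inj have "(1 :: 'a) = - 1" by (simp only: inj_eq)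
  hence "of_nat 2 = (0 :: 'a)" by (simp add: eq_neg_iff_add_eq_0)
  hence "CHAR('a) dvd 2" by (simp only: of_nat_eq_0_iff_char_dvd)
  hence "CHAR('a) = 2" by (metis CHAR_prime primes_dvd_imp_eq two_is_prime_nat)
  moreover have "of_nat CARD('a) = (0 :: 'a)" by (rule of_nat_CARD_eq_0)
  ultimately have "2 dvd CARD('a)" by (simp only: of_nat_eq_0_iff_char_dvd)
  with assms show False by presburger
qed

text \<open>The exponent for distance 20 violates the degree bound when q = 17, so a nonzero root is
  exhibited instead; it collides with the root 0.\<close>

lemma not_inj_sextic_17:
  fixes b c d :: "'a :: finite_field"
  assumes card: "CARD('a) = 17" and "d \<noteq> 0"
    and eqs: "c^2 + 2 * b * d = 0" "5 * b^3 + 9 * c * d = 0"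
    and nz: "(2 :: 'a) \<noteq> 0" "(3 :: 'a) \<noteq> 0"
  shows "\<not> inj (poly (sextic 0 0 b c d))"
proof
  assume inj: "inj (poly (sextic 0 0 b c d))"
  have c17: "(17 :: 'a) = 0" using of_nat_CARD_eq_0[where 'a = 'a] by (simp add: card)
  show False
  proof (cases "c = 0")
    case True
    have "b = 0" using eqs True nz \<open>d \<noteq> 0\<close> by auto
    \<comment> \<open>13 inverts 5 modulo 16, since 65 = 4 * 16 + 1.\<close>
    have "((- d) ^ 13) ^ 5 = - d" by (rule power_bij_solve[where l = 4]) (simp add: card)
    hence y: "((- d) ^ 13) ^ 5 + d = 0" by simp
    have "poly (sextic 0 0 b c d) x = x * (x ^ 5 + d)" for x
      by (simp add: poly_sextic True \<open>b = 0\<close> algebra_simps power_Suc[symmetric] del: power_Suc)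
    with y have "poly (sextic 0 0 b c d) ((- d) ^ 13) = poly (sextic 0 0 b c d) 0" by simp
    with inj have "(- d) ^ 13 = 0" by (simp only: inj_eq)
    with \<open>d \<noteq> 0\<close> show False by simp
  next
    case False
    obtain t where t: "t \<noteq> 0" "(5 :: 'a) \<noteq> 0" "20 * b = 18 * t^3" "20 * c = 18 * t^4" "20 * d = - (9 * t^5)"
      using sextic_family[OF eqs \<open>d \<noteq> 0\<close> False nz] by blast
    \<comment> \<open>On the one-parameter family, x = 10 t is a root modulo 17: the integer value
      is 20019710 t^6, a multiple of 17.\<close>
    have "20 * poly (sextic 0 0 b c d) (10 * t) = 17 * (1177630 * t^6)"
      unfolding poly_sextic using t(3-5) by algebra
    with c17 have "20 * poly (sextic 0 0 b c d) (10 * t) = 0" by simp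
    moreover have "(20 :: 'a) \<noteq> 0"
      using nz t(2) mult_eq_0_iff[of "2 * 2 :: 'a" 5] mult_eq_0_iff[of "2 :: 'a" 2] by simp
    ultimately have "poly (sextic 0 0 b c d) (10 * t) = 0" by (metis mult_eq_0_iff)
    also have "0 = poly (sextic 0 0 b c d) 0" by (simp add: poly_sextic)
    finally have "poly (sextic 0 0 b c d) (10 * t) = poly (sextic 0 0 b c d) 0" .
    with inj have "10 * t = 0" by (simp only: inj_eq)
    moreover have "(10 :: 'a) \<noteq> 0"
      using nz t(2) mult_eq_0_iff[of "2 :: 'a" 5] by simp
    ultimately show False using t(1) by simp
  qed
qed

text \<open>The distances 2 and 8 are the ones that the degree bound still admits for q = 11; these
  two conditions are separated to serve that field too.\<close>

lemma five_mod_six_conditions: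
  fixes a b c d :: "'a :: finite_field"
  assumes inj: "inj (poly (sextic 0 a b c d))"
    and card: "CARD('a) mod 6 = 5" "CARD('a) \<ge> 11" and char: "CHAR('a) mod 6 = 5"
  shows "a = 0" "c^2 + 2 * b * d = 0"
proof -
  define N where "N = (CARD('a) + 1) div 6"
  have N: "6 * N = CARD('a) + 1"
    using card(1) unfolding N_def by presburger
  show a: "a = 0" by (rule hermite_drop_2[OF inj N]) (use card in simp)
  have "(7 :: 'a) \<noteq> 0" using numeral_prime_neq_0[OF char, of 7] by simp
  thus "c^2 + 2 * b * d = 0"
    using hermite_drop_8[of b c d "Suc N"] inj N card a by simp
qed

lemma not_inj_five_mod_six:
  fixes a b c d :: "'a :: finite_field"
  assumes card: "CARD('a) mod 6 = 5" "CARD('a) > 11" and char: "CHAR('a) mod 6 = 5"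
  shows "\<not> inj (poly (sextic 0 a b c d))"
proof
  assume inj: "inj (poly (sextic 0 a b c d))"
  have card17: "CARD('a) \<ge> 17" using card by presburger
  define N where "N = (CARD('a) + 1) div 6"
  have N: "6 * N = CARD('a) + 1"
    using card(1) unfolding N_def by presburger
  have "of_nat 2 \<noteq> (0 :: 'a)" "of_nat 3 \<noteq> (0 :: 'a)" "of_nat 7 \<noteq> (0 :: 'a)"
    "of_nat 13 \<noteq> (0 :: 'a)" "of_nat 19 \<noteq> (0 :: 'a)" "of_nat 313 \<noteq> (0 :: 'a)"
    by (rule numeral_prime_neq_0[OF char], simp, simp)+
  hence nz: "(2 :: 'a) \<noteq> 0" "(3 :: 'a) \<noteq> 0" "(7 :: 'a) \<noteq> 0" "(13 :: 'a) \<noteq> 0"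
    "(19 :: 'a) \<noteq> 0" "(313 :: 'a) \<noteq> 0" by simp_all
  have a: "a = 0" and e1: "c^2 + 2 * b * d = 0"
    using five_mod_six_conditions[OF inj] card char by auto
  note inj = inj[unfolded a]
  have "d * (5 * b^3 + 9 * c * d) = 0"
    using hermite_drop_14[OF inj, of "N + 2"] N card17 nz e1 by simp
  moreover have "d \<noteq> 0"
  proof
    assume "d = 0"
    with e1 have "c = 0" by simp
    with \<open>d = 0\<close> inj not_inj_sextic_b[OF card(1), of b] show False by simp
  qed
  ultimately have e2: "5 * b^3 + 9 * c * d = 0" by simp
  have "CARD('a) \<noteq> 17"
    using not_inj_sextic_17[OF _ \<open>d \<noteq> 0\<close> e1 e2] inj nz by auto
  \<comment> \<open>After 17 the next number that is 5 modulo 6 is 23; distance 20 requires q >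
    21.\<close>
  hence card23: "CARD('a) \<ge> 23" using card card17 by presburger
  hence N3: "6 * (N + 3) = CARD('a) + 1 + 6 * 3" "CARD('a) > 3 + 6 * 3" using N by auto
  note drop = hermite_drop_20[OF inj N3 nz(3,4,5)]
  have "c \<noteq> 0"
  proof
    assume "c = 0"
    with e1 \<open>d \<noteq> 0\<close> nz have "b = 0" by simp
    with drop(1) \<open>c = 0\<close> \<open>d \<noteq> 0\<close> show False by simp
  qed
  then obtain t where t: "t \<noteq> 0" "(5 :: 'a) \<noteq> 0" "20 * b = 18 * t^3" "20 * c = 18 * t^4" "20 * d = - (9 * t^5)"
    using sextic_family[OF e1 e2 \<open>d \<noteq> 0\<close> _ nz(1,2)] by blast
  \<comment> \<open>The condition is multiplied by 20^6, so that only 20 b, 20 c and 20 d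
    occur.\<close>
  have "400 * 216 * (20 * d)^4 - 36 * 20 * ((20 * c)^5 + 20 * (20 * b) * (20 * c)^3 * (20 * d)
      + 30 * (20 * b)^2 * (20 * c) * (20 * d)^2)
      + 11 * (6 * (20 * b)^5 * (20 * d) + 15 * (20 * b)^4 * (20 * c)^2) = 0"
    using drop(2)[OF t(2)] by algebra
  \<comment> \<open>All terms have weight 20 and collapse to one monomial; 313 is 1 modulo 6, hence
    nonzero in the field.\<close>
  hence "2^7 * 3^11 * 313 * t^20 = 0"
    unfolding t(3-5) by algebra
  with nz t(1) show False
    by (simp only: mult_eq_0_iff power_eq_0_iff) auto
qed

section \<open>Characteristic 3\<close>

lemma coeff_mult_cube:
  fixes p q :: "'a :: comm_ring_1 poly"
  assumes "CHAR('a) = 3"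
  shows "coeff (p * q ^ 3) n = (\<Sum>j\<le>n div 3. coeff p (n - 3 * j) * coeff q j ^ 3)"
  by (rule coeff_mult_frobenius[where k = 1]) (simp_all add: assms)

lemma three_eq_0: "CHAR('a) = 3 \<Longrightarrow> (3 :: 'a :: comm_ring_1) = 0"
  by (metis of_nat_CHAR of_nat_numeral)

lemma two_eq_minus_1: "CHAR('a) = 3 \<Longrightarrow> (2 :: 'a :: comm_ring_1) = - 1"
proof -
  assume "CHAR('a) = 3"
  moreover have "(2 :: 'a) = 3 - 1" by simp
  ultimately show ?thesis by (simp only: three_eq_0) simp
qed

text \<open>Turns an identity modulo 3 into one over the integers with an explicit quotient
  \<open>w\<close>, which \<open>algebra\<close> can verify.\<close>

lemma eq_char_3I:
  fixes u v w :: "'a :: comm_ring_1"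
  assumes "CHAR('a) = 3" "u = v + 3 * w"
  shows "u = v"
  using assms by (simp add: three_eq_0)

lemma power_add_mult_cube: "x ^ (k + 3 * n) = x ^ k * (x ^ n :: 'a :: comm_monoid_mult) ^ 3"
  by (simp add: power_add power_mult[symmetric] mult.commute)

lemma coeff_1_power_pCons: "coeff (pCons 1 p ^ n) 1 = (of_nat n * coeff p 0 :: 'a :: comm_ring_1)"
proof (induction n)
  case (Suc n)
  have "coeff (pCons 1 p ^ n) 0 = 1" by (simp add: coeff_0_power)
  with Suc show ?case by (simp add: algebra_simps coeff_mult_0)
qed simp

section \<open>Hermite conditions from ternary digits\<close>

lemma coeff_sextic_square:
  fixes a b c d e :: "'a :: comm_ring_1"
  shows "coeff ([:1, a, b, c, d, e:] ^ 2) (Suc 0) = 2 * a"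
    and "coeff ([:1, a, b, c, d, e:] ^ 2) 2 = 2 * b + a^2"
    and "coeff ([:1, a, b, c, d, e:] ^ 2) 4 = 2 * d + 2 * a * c + b^2"
    and "coeff ([:1, a, b, c, d, e:] ^ 2) 5 = 2 * e + 2 * a * d + 2 * b * c"
    and "coeff ([:1, a, b, c, d, e:] ^ 2) 7 = 2 * b * e + 2 * c * d"
    and "coeff ([:1, a, b, c, d, e:] ^ 2) 10 = e^2"
    and "n > 10 \<Longrightarrow> coeff ([:1, a, b, c, d, e:] ^ 2) n = 0"
proof -
  assume "n > 10"
  moreover have "degree ([:1, a, b, c, d, e:] ^ 2) \<le> 10"
    by (rule order.trans[OF degree_power_le]) simp
  ultimately show "coeff ([:1, a, b, c, d, e:] ^ 2) n = 0" by (intro coeff_eq_0) simp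
qed (simp_all add: numeral_eq_Suc algebra_simps)

context
  fixes a b c d e :: "'a :: finite_field" and g :: "'a poly"
  assumes char: "CHAR('a) = 3" and inj: "inj (poly (sextic a b c d e))"
  defines "g \<equiv> [:1, a, b, c, d, e:]"
begin

text \<open>Cubing spreads the coefficients of \<open>g ^ R\<close> to multiples of 3, so up to
  index 5 only its first two, 1 and R a, contribute.\<close>

lemma coeff_sextic_2_plus:
  "coeff (g ^ (2 + 3 * R)) 4 = 2 * d + 2 * a * c + b^2 + 2 * a * (of_nat R * a) ^ 3"
  "coeff (g ^ (2 + 3 * R)) 5 = 2 * e + 2 * a * d + 2 * b * c + (2 * b + a^2) * (of_nat R * a) ^ 3"
proof -
  have eq: "g ^ (2 + 3 * R) = g^2 * (g ^ R) ^ 3"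
    by (rule power_add_mult_cube)
  have "coeff (g ^ R) 0 = 1" "coeff (g ^ R) (Suc 0) = of_nat R * a"
    using coeff_1_power_pCons[of "[:a, b, c, d, e:]" R] by (simp_all add: g_def coeff_0_power)
  thus "coeff (g ^ (2 + 3 * R)) 4 = 2 * d + 2 * a * c + b^2 + 2 * a * (of_nat R * a) ^ 3"
    "coeff (g ^ (2 + 3 * R)) 5 = 2 * e + 2 * a * d + 2 * b * c + (2 * b + a^2) * (of_nat R * a) ^ 3"
    unfolding eq coeff_mult_cube[OF char] unfolding g_def
    by (simp_all add: coeff_sextic_square)
qed

text \<open>The exponents of the next three lemmas have the ternary digits \<open>01...12\<close>, \<open>01...121\<close>
  and \<open>01...122\<close>.\<close>
lemma hermite_char3_drop_4:
  assumes "CARD('a) = 9 * (2 * R + 1)"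
  shows "2 * d + 2 * a * c + b^2 + 2 * a * (of_nat R * a) ^ 3 = 0"
proof -
  have "coeff (g ^ (2 + 3 * R)) 4 = 0"
    unfolding g_def by (rule hermite_sextic[OF inj]) (use assms in auto)
  thus ?thesis by (simp only: coeff_sextic_2_plus)
qed

lemma hermite_char3_drop_16:
  assumes "CARD('a) = 27 * (2 * R + 1)"
  shows "d * (2 * d + 2 * a * c + b^2 + 2 * a * (of_nat R * a) ^ 3) ^ 3
       + a * (2 * e + 2 * a * d + 2 * b * c + (2 * b + a^2) * (of_nat R * a) ^ 3) ^ 3 = 0"
proof -
  let ?N = "2 + 3 * R"
  have eq: "g ^ (1 + 3 * ?N) = g * (g ^ ?N) ^ 3"
    using power_add_mult_cube[of g 1 ?N] by simp
  have "coeff (g ^ (1 + 3 * ?N)) 16 = 0"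
    unfolding g_def by (rule hermite_sextic[OF inj]) (use assms in auto)
  hence "(\<Sum>j\<le>5. coeff g (16 - 3 * j) * coeff (g ^ ?N) j ^ 3) = 0"
    unfolding eq coeff_mult_cube[OF char] by simp
  \<comment> \<open>\<open>g\<close> has degree at most 5, so only j = 4 and j = 5 remain, where 16
    - 3 j is 4 and 1.\<close>
  hence "d * coeff (g ^ ?N) 4 ^ 3 + a * coeff (g ^ ?N) 5 ^ 3 = 0"
    by (simp add: sum_atMost_numeral g_def coeff_pCons eval_nat_numeral)
  thus ?thesis by (simp only: coeff_sextic_2_plus)
qed

lemma hermite_char3_drop_22:
  assumes "CARD('a) = 27 * (2 * R + 1)" "a = 0"
  shows "(b * e + c * d) * (e + b * c) = 0"
proof -
  define N where "N = 2 + 3 * R"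
  have eq: "g ^ (2 + 3 * N) = g^2 * (g ^ N) ^ 3"
    by (rule power_add_mult_cube)
  have F4: "2 * d + b^2 = 0"
    using hermite_char3_drop_4[of "3 * R + 1"] assms by simp
  have "coeff (g ^ (2 + 3 * N)) 22 = 0"
    unfolding g_def by (rule hermite_sextic[OF inj]) (use assms in \<open>auto simp: N_def\<close>)
  hence S: "(\<Sum>j\<le>7. coeff (g^2) (22 - 3 * j) * coeff (g ^ N) j ^ 3) = 0"
    unfolding eq coeff_mult_cube[OF char] by simp
  \<comment> \<open>The degree of \<open>g^2\<close> leaves j = 4, 5, 6, 7. The terms for j = 4 and
    j = 6 contain 2 d + b^2 = 0 and the one for j = 7 contains a = 0, so a single product is
    left.\<close>
  have F: "coeff (g^2) (Suc 0) = 0" "coeff (g^2) 4 = 0" "coeff (g^2) 7 = 2 * (b * e + c * d)"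
    "n > 10 \<Longrightarrow> coeff (g^2) n = 0" for n
    using F4 assms(2) by (simp_all add: g_def coeff_sextic_square algebra_simps)
  have S4: "coeff (g ^ N) 4 = 0" and S5: "coeff (g ^ N) 5 = 2 * (e + b * c)"
    unfolding N_def coeff_sextic_2_plus using F4 assms(2) by (simp_all add: algebra_simps)
  have "2 * (b * e + c * d) * (2 * (e + b * c)) ^ 3 = 0"
    using S by (simp add: sum_atMost_numeral F S4 S5 del: power_Suc)
  hence "(b * e + c * d = 0 \<or> e + b * c = 0) \<or> (2 :: 'a) = 0"
    by (simp only: mult_eq_0_iff power_eq_0_iff) blast
  moreover have "(2 :: 'a) \<noteq> 0"
    by (simp add: two_eq_minus_1[OF char])
  ultimately show ?thesis by (simp only: mult_eq_0_iff) blast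
qed

end

text \<open>Passing from \<open>j\<close> to \<open>j + 1\<close> multiplies the two coefficients by a Frobenius twist of a
  \<open>2 * 2\<close> Hasse--Witt matrix, for which \<open>(1, - 1)\<close> is an eigenvector with eigenvalue \<open>1 - c\<close>.\<close>
lemma coeff_hasse_witt:
  fixes c :: "'a :: finite_field"
  assumes char: "CHAR('a) = 3"
  defines "f \<equiv> sextic 1 0 c (- c - 1) (c - 1)"
  shows "coeff (f ^ ((3 ^ j - 1) div 2)) (3 ^ j - 1) - coeff (f ^ ((3 ^ j - 1) div 2)) (2 * 3 ^ j - 1)
    = (1 - c) ^ ((3 ^ j - 1) div 2)"
proof (induction j)
  case 0
  show ?case by simp
next
  case (Suc j)
  define M where "M = (3 :: nat) ^ j"
  define n where "n = (M - 1) div 2"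
  have M: "odd M" "M > 0" by (auto simp: M_def)
  have n: "M = 2 * n + 1" using M by (auto simp: n_def)
  have n': "(3 ^ Suc j - 1) div 2 = n + M" using n by (simp add: M_def[symmetric])
  have deg: "degree (f ^ n) \<le> 6 * n"
    by (rule order.trans[OF degree_power_le]) (simp add: f_def)
  have frob: "coeff (f ^ n * f ^ M) k = (\<Sum>i\<le>k div M. coeff (f ^ n) (k - M * i) * coeff f i ^ M)" for k
    by (rule coeff_mult_frobenius) (use char in \<open>auto simp: M_def\<close>)
  have zero: "coeff (f ^ n) k = 0" if "k > 6 * n" for k
    using deg that by (intro coeff_eq_0) simp
  have cf: "coeff f 0 = 0" "coeff f (Suc 0) = c - 1" "coeff f 2 = - c - 1" "coeff f 3 = c" "coeff f 4 = 0" "coeff f 5 = 1"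
    by (simp_all add: f_def sextic_def eval_nat_numeral)
  \<comment> \<open>The degree of \<open>f ^ n\<close> is at most 6 n = 3 M - 3. Among the indices
    congruent to - 1 modulo M only M - 1 and 2 M - 1 can occur, so the recursion closes on two
    coefficients.\<close>
  let ?u = "coeff (f ^ n) (M - 1)" and ?v = "coeff (f ^ n) (2 * M - 1)"
  have d1: "(3 * M - 1) div M = 2" "(6 * M - 1) div M = 5" using M by (auto simp: div_nat_eqI)
  have u: "coeff (f ^ (n + M)) (3 * M - 1) = ?v * (c - 1) ^ M + ?u * (- c - 1) ^ M"
    using M unfolding power_add frob d1
    by (simp add: sum_atMost_numeral cf zero_power)
  have v: "coeff (f ^ (n + M)) (6 * M - 1) = ?u"
    using M unfolding power_add frob d1
    by (simp add: sum_atMost_numeral cf zero n)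
  \<comment> \<open>The M-th power is additive, and - c - 2 = 1 - c in characteristic 3.\<close>
  have "(- c - 1) ^ M - 1 = (- c - 1 + - 1) ^ M"
    using M by (subst freshmans_dream'[where n = j]) (auto simp: char M_def)
  also have "- c - 1 + - 1 = 1 - c" using two_eq_minus_1[OF char] by (simp add: algebra_simps)
  finally have X: "(- c - 1) ^ M = 1 + (1 - c) ^ M" by (simp add: algebra_simps)
  have Y: "(c - 1) ^ M = - ((1 - c) ^ M)"
    using M by (metis minus_diff_eq power_minus_odd)
  have "coeff (f ^ (n + M)) (3 * M - 1) - coeff (f ^ (n + M)) (6 * M - 1) = (1 - c) ^ M * (?u - ?v)"
    unfolding u v X Y by (simp add: algebra_simps)
  also have "?u - ?v = (1 - c) ^ n" using Suc by (simp add: M_def n_def)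
  finally show ?case unfolding n' by (simp add: M_def[symmetric] power_add mult.commute)
qed

lemma cube_root_exists:
  fixes z :: "'a :: finite_field"
  assumes "CARD('a) = 3 * m"
  shows "(z ^ m) ^ 3 = z"
proof -
  have "(z ^ m) ^ 3 = z ^ (3 * m)" by (simp add: power_mult[symmetric] mult.commute)
  also have "\<dots> = z ^ CARD('a)" by (simp only: assms)
  also have "\<dots> = z" by (rule finite_field_power_card_eq_same)
  finally show ?thesis .
qed

text \<open>In characteristic 3 the difference f(x + 1) - f(x) is 1 + c + e - x^3, and every element
  is a cube, so the difference has a zero.\<close>

lemma not_inj_sextic_char3_0:
  fixes c e :: "'a :: finite_field"
  assumes char: "CHAR('a) = 3" and card: "3 dvd CARD('a)"
  shows "\<not> inj (poly (sextic 0 0 c 0 e))"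
proof
  assume inj: "inj (poly (sextic 0 0 c 0 e))"
  obtain m where "CARD('a) = 3 * m" using card by blast
  hence x: "((1 + c + e) ^ m) ^ 3 = 1 + c + e" by (rule cube_root_exists)
  define x where "x = (1 + c + e) ^ m"
  have "x ^ 3 = 1 + c + e" unfolding x_def by (rule x)
  moreover have "poly (sextic 0 0 c 0 e) (x + 1) - poly (sextic 0 0 c 0 e) x = 1 + c + e - x ^ 3"
    by (rule eq_char_3I[OF char, where w = "2 * x^5 + 5 * x^4 + 7 * x^3 + 5 * x^2 + 2 * x + c * x^2 + c * x"])
       (unfold poly_sextic, algebra)
  ultimately have "poly (sextic 0 0 c 0 e) (x + 1) = poly (sextic 0 0 c 0 e) x" by simp
  with inj have "x + 1 = x" by (simp only: inj_eq)
  thus False by simp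
qed

text \<open>The polynomial is a quadratic polynomial in \<open>x^3 - b x\<close>.\<close>
lemma not_inj_sextic_composite:
  fixes b c :: "'a :: finite_field"
  assumes char: "CHAR('a) = 3"
  shows "\<not> inj (poly (sextic 0 b c (b^2) (- (b * c))))"
proof
  let ?f = "poly (sextic 0 b c (b^2) (- (b * c)))"
  assume inj: "inj ?f"
  define L where "L = (\<lambda>x. x ^ 3 - b * x)"
  have f: "?f x = L x * (L x + c)" for x
    by (rule eq_char_3I[OF char, where w = "b * x^4"]) (unfold poly_sextic L_def, algebra)
  have "inj L"
  proof (rule injI)
    fix x y assume "L x = L y"
    hence "?f x = ?f y" by (simp only: f)
    with inj show "x = y" by (simp only: inj_eq)
  qed
  hence "surj L" by (simp add: finite_UNIV_inj_surj)
  \<comment> \<open>As \<open>L\<close> is onto, the quadratic u (u + c) inherits injectivity on the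
    whole field, which no quadratic has in odd characteristic.\<close>
  have h: "u = v" if "u * (u + c) = v * (v + c)" for u v
  proof -
    obtain x y where "u = L x" "v = L y" using \<open>surj L\<close> by (metis surjD)
    with that have "?f x = ?f y" by (simp only: f)
    with inj \<open>u = L x\<close> \<open>v = L y\<close> show ?thesis by (simp only: inj_eq)
  qed
  have "c = 0" using h[of 0 "- c"] by simp
  hence "(1 :: 'a) = - 1" using h[of 1 "- 1"] by simp
  thus False using two_eq_minus_1[OF char] by (metis add_cancel_right_left one_add_one zero_neq_one)
qed

text \<open>Once d = b^2, the product from distance 22 becomes b (e + b c)^2. Either factor
  vanishing leads to a family already excluded.\<close>

lemma not_inj_sextic_char3_a_0:
  fixes b c d e :: "'a :: finite_field"
  assumes char: "CHAR('a) = 3" and card: "CARD('a) = 27 * (2 * R + 1)"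
  shows "\<not> inj (poly (sextic 0 b c d e))"
proof
  assume inj: "inj (poly (sextic 0 b c d e))"
  have "CARD('a) = 9 * (2 * (3 * R + 1) + 1)" using card by simp
  from hermite_char3_drop_4[OF char inj this] have d: "d = b^2"
    by (simp add: two_eq_minus_1[OF char])
  have "(b * e + c * d) * (e + b * c) = 0"
    by (rule hermite_char3_drop_22[OF char inj card refl])
  hence "b * (e + b * c)^2 = 0" unfolding d by algebra
  hence "b = 0 \<or> e = - (b * c)" by (auto simp: add_eq_0_iff2)
  thus False
    using inj d not_inj_sextic_char3_0[OF char, of c e] not_inj_sextic_composite[OF char, of b c] card
    by auto
qed

lemma not_inj_sextic_char3_a_1:
  fixes c d e :: "'a :: finite_field"
  assumes char: "CHAR('a) = 3" and card: "CARD('a) = 3 ^ k" "k \<ge> 4"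
  shows "\<not> inj (poly (sextic 1 0 c d e))"
proof
  assume inj: "inj (poly (sextic 1 0 c d e))"
  define M where "M = (3 :: nat) ^ (k - 2)"
  define R where "R = (3 ^ (k - 4) - 1) div (2 :: nat)"
  have R: "3 ^ (k - 4) = 2 * R + 1"
    unfolding R_def by (subst dvd_mult_div_cancel) auto
  have k: "k = (k - 4) + 4" "k = (k - 2) + 2" using card by simp_all
  have card1: "CARD('a) = 81 * (2 * R + 1)"
    by (subst card, subst k(1), simp only: power_add R) simp
  have card2: "CARD('a) = 9 * M"
    by (subst card, subst k(2), simp only: power_add M_def) simp
  note two = two_eq_minus_1[OF char] three_eq_0[OF char]
  \<comment> \<open>Here k \<ge> 4 enters: for q = 27 the multiplier in the condition at distance 16
    would be 0 instead of 1.\<close>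
  have o: "of_nat (9 * R + 4) = (1 :: 'a)" "of_nat (3 * R + 1) = (1 :: 'a)"
  proof -
    have "of_nat (9 * R + 4) = (3 * (3 * of_nat R + 1) + 1 :: 'a)" by simp
    thus "of_nat (9 * R + 4) = (1 :: 'a)" by (simp only: two) simp
    have "of_nat (3 * R + 1) = (3 * of_nat R + 1 :: 'a)" by simp
    thus "of_nat (3 * R + 1) = (1 :: 'a)" by (simp only: two) simp
  qed
  have "CARD('a) = 9 * (2 * (9 * R + 4) + 1)" using card1 by simp
  from hermite_char3_drop_4[OF char inj this] have "- d - c - 1 = 0"
    unfolding o by (simp add: two)
  hence d: "d = - c - 1" by algebra
  have "CARD('a) = 27 * (2 * (3 * R + 1) + 1)" using card1 by simp
  from hermite_char3_drop_16[OF char inj this] have "2 * e + 2 * d + 1 = 0"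
    unfolding o d by (simp add: two algebra_simps)
  hence "e = c - 1 + 3 * (e - c)" unfolding d by algebra
  hence e: "e = c - 1" by (rule eq_char_3I[OF char])
  define f where "f = sextic 1 0 c (- c - 1) (c - 1)"
  define n where "n = (M - 1) div 2"
  have "odd M" "M > 1" using card(2) one_less_power[of "3 :: nat" "k - 2"] by (auto simp: M_def)
  hence n: "M = 2 * n + 1" by (simp add: n_def)
  have "degree (f ^ n) \<le> 6 * n"
    by (rule order.trans[OF degree_power_le]) (simp add: f_def)
  hence zero: "coeff (f ^ n) i = 0" if "i > 6 * n" for i
    using that by (intro coeff_eq_0) simp
  have f2: "coeff (f^2) 7 = 2 * (c - 1) + 2 * (- c - 1)" "coeff (f^2) 8 = 2 * (- c - 1) + 2 * c"
    by (simp_all add: f_def sextic_def numeral_eq_Suc)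
  txt \<open>The exponent has the ternary digits \<open>021...1\<close>.\<close>
  have "coeff (f ^ (n + 2 * M)) (CARD('a) - 1) = 0"
    by (rule hermite_criterion) (use inj d e n card2 \<open>M > 1\<close> in \<open>auto simp: f_def\<close>)
  hence "coeff (f ^ n * (f^2) ^ M) (9 * M - 1) = 0"
    by (simp only: power_add power_mult card2)
  also have "coeff (f ^ n * (f^2) ^ M) (9 * M - 1) =
      (\<Sum>i\<le>(9 * M - 1) div M. coeff (f ^ n) (9 * M - 1 - M * i) * coeff (f^2) i ^ M)"
    by (rule coeff_mult_frobenius[where k = "k - 2"]) (simp_all add: char M_def)
  also have "(9 * M - 1) div M = 8" using \<open>M > 1\<close> by (auto simp: div_nat_eqI)
  \<comment> \<open>For i \<le> 6 the index is at least 3 M - 1 and exceeds the degree 3 M - 3 of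
    \<open>f ^ n\<close>.\<close>
  also have "(\<Sum>i\<le>8. coeff (f ^ n) (9 * M - 1 - M * i) * coeff (f^2) i ^ M)
      = coeff (f ^ n) (2 * M - 1) * coeff (f^2) 7 ^ M + coeff (f ^ n) (M - 1) * coeff (f^2) 8 ^ M"
    using \<open>M > 1\<close> by (simp add: sum_atMost_numeral zero n)
  also have "coeff (f^2) 7 = - 1"
    by (rule eq_char_3I[OF char, where w = "- 1"]) (simp add: f2)
  also have "coeff (f^2) 8 = 1"
    by (rule eq_char_3I[OF char, where w = "- 1"]) (simp add: f2)
  finally have "coeff (f ^ n) (M - 1) - coeff (f ^ n) (2 * M - 1) = 0"
    using \<open>odd M\<close> by simp
  hence "(1 - c) ^ n = 0"
    using coeff_hasse_witt[OF char, of c "k - 2"] by (simp add: f_def n_def M_def)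
  hence "c = 1" by simp
  hence "poly (sextic 1 0 c d e) 0 = poly (sextic 1 0 c d e) (- 1)"
    unfolding d e by (simp add: poly_sextic two)
  with inj have "(0 :: 'a) = - 1" by (simp only: inj_eq)
  thus False by simp
qed

section \<open>Affine changes of variable\<close>

lemma inj_affine_comp:
  fixes f g :: "'a :: field \<Rightarrow> 'a"
  assumes "u \<noteq> 0" "r \<noteq> 0" "\<And>x. g (u * x + t) = r * f x + s"
  shows "inj g \<longleftrightarrow> inj f"
proof
  assume "inj g"
  show "inj f"
  proof (rule injI)
    fix x y assume "f x = f y"
    hence "g (u * x + t) = g (u * y + t)" by (simp only: assms(3))
    with \<open>inj g\<close> have "u * x + t = u * y + t" by (simp only: inj_eq)
    thus "x = y" using assms(1) by simp
  qed
next
  assume "inj f"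
  show "inj g"
  proof (rule injI)
    fix x y assume "g x = g y"
    moreover have "g z = r * f ((z - t) / u) + s" for z
      using assms(3)[of "(z - t) / u"] assms(1) by simp
    ultimately have "f ((x - t) / u) = f ((y - t) / u)" using assms(2) by simp
    with \<open>inj f\<close> have "(x - t) / u = (y - t) / u" by (simp only: inj_eq)
    thus "x = y" using assms(1) by simp
  qed
qed

lemma inj_sextic_scale:
  fixes u :: "'a :: field"
  assumes "u \<noteq> 0"
  shows "inj (poly (sextic (u * a) (u^2 * b) (u^3 * c) (u^4 * d) (u^5 * e))) \<longleftrightarrow> inj (poly (sextic a b c d e))"
proof (rule inj_affine_comp)
  show "u \<noteq> 0" by fact
  show "u^6 \<noteq> 0" using assms by simp
  show "poly (sextic (u * a) (u^2 * b) (u^3 * c) (u^4 * d) (u^5 * e)) (u * x + 0) =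
    u^6 * poly (sextic a b c d e) x + 0" for x
    unfolding poly_sextic by algebra
qed

text \<open>The conjugate of \<open>sextic 1 0 c d e\<close> under x \<mapsto> a x - b, made monic,
  without its constant term and with integer coefficients reduced modulo 3. The a and b of the
  families with an x^5 term are these parameters.\<close>

definition translated_sextic :: "'a \<Rightarrow> 'a \<Rightarrow> 'a \<Rightarrow> 'a \<Rightarrow> 'a \<Rightarrow> 'a :: comm_ring_1 poly" where
  "translated_sextic a b c d e = sextic a (2 * a * b) (a^3 * c + a * b^2 + 2 * b^3) (a^4 * d + a * b^3)
      (a^5 * e + 2 * a^4 * d * b + 2 * a * b^4)"

lemma inj_translated_sextic:
  fixes a :: "'a :: field"
  assumes char: "CHAR('a) = 3" and "a \<noteq> 0"
  shows "inj (poly (translated_sextic a b c d e)) \<longleftrightarrow> inj (poly (sextic 1 0 c d e))"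
proof (rule inj_affine_comp)
  show "a \<noteq> 0" by fact
  show "a^6 \<noteq> 0" using \<open>a \<noteq> 0\<close> by simp
  show "poly (translated_sextic a b c d e) (a * x + (- b)) =
    a^6 * poly (sextic 1 0 c d e) x + - poly (sextic a 0 (a^3 * c) (a^4 * d) (a^5 * e)) b" for x
    by (rule eq_char_3I[OF char, where w = "- 2 * a^5 * b * x^5 + 5 * a^4 * b^2 * x^4 - 6 * a^3 * b^3 * x^3
        + 3 * a^2 * b^4 * x^2 - a^5 * b * x^4 + a^4 * b^2 * x^3 - a^5 * b * c * x^2 + a^4 * b^2 * c * x"])
       (unfold poly_sextic translated_sextic_def, algebra)
qed

text \<open>The x^4 coefficient 2 a \<beta> takes every value as \<beta> varies, because a is
  nonzero; the other equations then determine c', d', e' in turn.\<close>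

lemma sextic_eq_translated_sextic:
  fixes a b c d e :: "'a :: field"
  assumes char: "CHAR('a) = 3" and "a \<noteq> 0"
  obtains \<beta> c' d' e' where "sextic a b c d e = translated_sextic a \<beta> c' d' e'"
proof -
  define \<beta> where "\<beta> = - (b / a)"
  define d' where "d' = (d - a * \<beta>^3) / a^4"
  define c' where "c' = (c - a * \<beta>^2 - 2 * \<beta>^3) / a^3"
  define e' where "e' = (e - 2 * a^4 * d' * \<beta> - 2 * a * \<beta>^4) / a^5"
  have "b = 2 * a * \<beta>" using assms by (simp add: \<beta>_def two_eq_minus_1)
  moreover have "c = a^3 * c' + a * \<beta>^2 + 2 * \<beta>^3" using assms(2) by (simp add: c'_def)
  moreover have "d = a^4 * d' + a * \<beta>^3" using assms(2) by (simp add: d'_def)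
  moreover have "e = a^5 * e' + 2 * a^4 * d' * \<beta> + 2 * a * \<beta>^4" using assms(2) by (simp add: e'_def)
  ultimately have "sextic a b c d e = translated_sextic a \<beta> c' d' e'"
    unfolding translated_sextic_def by (simp only:)
  thus ?thesis by (rule that)
qed

lemma not_inj_sextic_char3:
  fixes a b c d e :: "'a :: finite_field"
  assumes char: "CHAR('a) = 3" and card: "CARD('a) = 3 ^ k" "k \<ge> 4"
  shows "\<not> inj (poly (sextic a b c d e))"
proof (cases "a = 0")
  case True
  define R where "R = (3 ^ (k - 3) - 1) div (2 :: nat)"
  have R: "3 ^ (k - 3) = 2 * R + 1"
    unfolding R_def by (subst dvd_mult_div_cancel) auto
  have k: "k = (k - 3) + 3" using card by simp
  have "CARD('a) = 27 * (2 * R + 1)"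
    by (subst card, subst k(1), simp only: power_add R) simp
  from not_inj_sextic_char3_a_0[OF char this] True show ?thesis by simp
next
  case False
  obtain \<beta> c' d' e' where "sextic a b c d e = translated_sextic a \<beta> c' d' e'"
    using sextic_eq_translated_sextic[OF char False] .
  thus ?thesis
    using inj_translated_sextic[OF char False] not_inj_sextic_char3_a_1[OF char card] by simp
qed

section \<open>Models of small fields\<close>

text \<open>The operations are parameters so that one evaluator serves all three models. Being monic
  without constant term, the polynomial starts from x + a and ends with a factor x.\<close>

definition horner6 :: "('m \<Rightarrow> 'm \<Rightarrow> 'm) \<Rightarrow> ('m \<Rightarrow> 'm \<Rightarrow> 'm) \<Rightarrow> 'm \<Rightarrow> 'm \<Rightarrow> 'm \<Rightarrow> 'm \<Rightarrow> 'm \<Rightarrow> 'm \<Rightarrow> 'm" where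
  "horner6 add mul a b c d e x =
    mul (add (mul (add (mul (add (mul (add (mul (add x a) x) b) x) c) x) d) x) e) x"

text \<open>The type \<open>'a\<close> is an abstract field of known size; a concrete list of
  representatives makes injectivity decidable by evaluation.\<close>

locale finite_field_model =
  fixes h :: "'m \<Rightarrow> 'a :: finite_field" and els :: "'m list" and add mul :: "'m \<Rightarrow> 'm \<Rightarrow> 'm"
  assumes bij: "bij_betw h (set els) UNIV" and distinct_els: "distinct els"
    and add_closed: "x \<in> set els \<Longrightarrow> y \<in> set els \<Longrightarrow> add x y \<in> set els"
    and mul_closed: "x \<in> set els \<Longrightarrow> y \<in> set els \<Longrightarrow> mul x y \<in> set els"
    and h_add: "h (add x y) = h x + h y"
    and h_mul: "h (mul x y) = h x * h y"
begin

lemma obtain_rep: obtains x where "x \<in> set els" "y = h x"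
  using bij unfolding bij_betw_def by blast

lemma inj_sextic_iff:
  assumes "a \<in> set els" "b \<in> set els" "c \<in> set els" "d \<in> set els" "e \<in> set els"
  shows "inj (poly (sextic (h a) (h b) (h c) (h d) (h e))) \<longleftrightarrow>
    distinct (map (horner6 add mul a b c d e) els)"
proof -
  let ?f = "poly (sextic (h a) (h b) (h c) (h d) (h e))" and ?g = "horner6 add mul a b c d e"
  have fg: "?f (h x) = h (?g x)" for x
    by (simp add: horner6_def h_add h_mul sextic_def algebra_simps)
  have g: "?g ` set els \<subseteq> set els"
    using assms by (auto simp: horner6_def intro!: add_closed mul_closed)
  have "inj ?f \<longleftrightarrow> inj_on ?f (h ` set els)"
    using bij by (simp add: bij_betw_def)
  also have "\<dots> \<longleftrightarrow> inj_on (?f \<circ> h) (set els)"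
    using bij by (metis bij_betw_def comp_inj_on_iff)
  also have "?f \<circ> h = h \<circ> ?g" by (simp add: fg fun_eq_iff)
  also have "inj_on (h \<circ> ?g) (set els) \<longleftrightarrow> inj_on ?g (set els)"
    using bij g by (meson bij_betw_imp_inj_on comp_inj_on inj_on_imageI2 inj_on_subset)
  also have "\<dots> \<longleftrightarrow> distinct (map ?g els)"
    using distinct_els by (simp add: distinct_map)
  finally show ?thesis .
qed

end

text \<open>The prime field as balanced digits 0, 1, - 1; constructors let the checks reduce by
  pattern matching.\<close>

datatype trit = Tz | Tp | Tm

fun trit_neg where
  "trit_neg Tz = Tz" | "trit_neg Tp = Tm" | "trit_neg Tm = Tp"

fun trit_add where
  "trit_add Tz y = y" | "trit_add x Tz = x"
| "trit_add Tp Tp = Tm" | "trit_add Tp Tm = Tz" | "trit_add Tm Tp = Tz" | "trit_add Tm Tm = Tp"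

fun trit_mul where
  "trit_mul Tz y = Tz" | "trit_mul Tp y = y" | "trit_mul Tm y = trit_neg y"

fun of_trit :: "trit \<Rightarrow> 'a :: comm_ring_1" where
  "of_trit Tz = 0" | "of_trit Tp = 1" | "of_trit Tm = - 1"

lemma of_trit_add: "CHAR('a) = 3 \<Longrightarrow> of_trit (trit_add x y) = (of_trit x + of_trit y :: 'a :: comm_ring_1)"
  by (cases x; cases y) (simp_all add: two_eq_minus_1)

lemma of_trit_mul: "of_trit (trit_mul x y) = (of_trit x * of_trit y :: 'a :: comm_ring_1)"
  by (cases x; cases y) simp_all

lemma UNIV_trit: "UNIV = set [Tz, Tp, Tm]"
  by (auto intro: trit.exhaust)

text \<open>A pair (a, b) stands for a + b i with i^2 = - 1.\<close>

fun f9_add where "f9_add (a, b) (c, d) = (trit_add a c, trit_add b d)"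

fun f9_mul where
  "f9_mul (a, b) (c, d) =
    (trit_add (trit_mul a c) (trit_neg (trit_mul b d)), trit_add (trit_mul a d) (trit_mul b c))"

definition f9_elems where "f9_elems = List.product [Tz, Tp, Tm] [Tz, Tp, Tm]"

text \<open>The condition at distance 4 forces d = - c, which leaves 81 pairs (c, e).\<close>

lemma f9_check_1:
  "list_all (\<lambda>c. list_all (\<lambda>e.
     distinct (map (horner6 f9_add f9_mul (Tp, Tz) (Tz, Tz) c (f9_mul (Tm, Tz) c) e) f9_elems) \<longleftrightarrow>
     (c, e) \<in> set [((Tp, Tz), (Tm, Tz)), ((Tp, Tm), (Tz, Tp)), ((Tm, Tp), (Tz, Tp)), ((Tm, Tz), (Tm, Tp)),
       ((Tp, Tp), (Tz, Tm)), ((Tm, Tm), (Tz, Tm)), ((Tm, Tz), (Tm, Tm))]) f9_elems) f9_elems"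
  by code_simp

text \<open>Without x^5 the condition reads d = b^2; a nonzero square b can be scaled to 1.\<close>

lemma f9_check_0:
  "list_all (\<lambda>c. list_all (\<lambda>e.
     distinct (map (horner6 f9_add f9_mul (Tz, Tz) (Tp, Tz) c (Tp, Tz) e) f9_elems) \<longleftrightarrow>
     (c, e) \<in> set [((Tz, Tz), (Tp, Tz)), ((Tz, Tz), (Tm, Tz)), ((Tp, Tz), (Tz, Tz)), ((Tm, Tz), (Tz, Tz)),
       ((Tz, Tp), (Tp, Tm)), ((Tz, Tm), (Tm, Tp)), ((Tz, Tm), (Tp, Tp)), ((Tz, Tp), (Tm, Tm)),
       ((Tp, Tp), (Tz, Tm)), ((Tm, Tm), (Tz, Tp)), ((Tp, Tm), (Tz, Tp)), ((Tm, Tp), (Tz, Tm))]) f9_elems) f9_elems"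
  by code_simp

text \<open>1 + i generates the multiplicative group and represents the nonsquares up to
  scaling.\<close>

lemma f9_check_nonsquare:
  "list_all (\<lambda>c. list_all (\<lambda>e.
     \<not> distinct (map (horner6 f9_add f9_mul (Tz, Tz) (Tp, Tp) c (f9_mul (Tp, Tp) (Tp, Tp)) e) f9_elems))
     f9_elems) f9_elems"
  by code_simp

lemma f9_check_square_classes:
  "list_all (\<lambda>b. b = (Tz, Tz) \<or> list_ex (\<lambda>u. b = f9_mul u u \<or> b = f9_mul (Tp, Tp) (f9_mul u u)) f9_elems) f9_elems"
  by code_simp

lemma f9_check_inverse:
  "list_all (\<lambda>x. x = (Tz, Tz) \<or> list_ex (\<lambda>y. f9_mul x y = (Tp, Tz)) f9_elems) f9_elems"
  by code_simp

text \<open>Triples are coordinates with respect to \<open>1, \<theta>, \<theta>^2\<close>, where \<open>\<theta>^3 = \<theta> + 1\<close>.\<close>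
fun f27_add where "f27_add (a, b, c) (a', b', c') = (trit_add a a', trit_add b b', trit_add c c')"

text \<open>\<open>c3\<close> and \<open>c4\<close> are the coefficients of \<theta>^3 and
  \<theta>^4 in the plain product, folded back by \<theta>^3 = \<theta> + 1 and \<theta>^4 =
  \<theta>^2 + \<theta>.\<close>

fun f27_mul where
  "f27_mul (a0, a1, a2) (b0, b1, b2) =
    (let c3 = trit_add (trit_mul a1 b2) (trit_mul a2 b1); c4 = trit_mul a2 b2 in
      (trit_add (trit_mul a0 b0) c3,
       trit_add (trit_add (trit_mul a0 b1) (trit_mul a1 b0)) (trit_add c3 c4),
       trit_add (trit_add (trit_mul a0 b2) (trit_mul a1 b1)) (trit_add (trit_mul a2 b0) c4)))"

definition f27_elems where "f27_elems = List.product [Tz, Tp, Tm] (List.product [Tz, Tp, Tm] [Tz, Tp, Tm])"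

definition f27_cube where "f27_cube x = f27_mul x (f27_mul x x)"

definition f27_neg where "f27_neg = f27_mul (Tm, Tz, Tz)"

lemma f27_check_inverse:
  "list_all (\<lambda>x. x = (Tz, Tz, Tz) \<or> list_ex (\<lambda>y. f27_mul x y = (Tp, Tz, Tz)) f27_elems) f27_elems"
  by code_simp

text \<open>The Hermite conditions give c = - d - 1 and e = d^9 - d, so 27 cases suffice.\<close>

lemma f27_check_1:
  "list_all (\<lambda>d.
     distinct (map (horner6 f27_add f27_mul (Tp, Tz, Tz) (Tz, Tz, Tz) (f27_neg (f27_add d (Tp, Tz, Tz))) d
       (f27_add (f27_cube (f27_cube d)) (f27_neg d))) f27_elems) \<longleftrightarrow> d = (Tm, Tz, Tz)) f27_elems"
  by code_simp

definition z11_elems :: "int list" where "z11_elems = [0,1,2,3,4,5,6,7,8,9,10]"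

definition z11_add :: "int \<Rightarrow> int \<Rightarrow> int" where "z11_add x y = (x + y) mod 11"
definition z11_mul :: "int \<Rightarrow> int \<Rightarrow> int" where "z11_mul x y = (x * y) mod 11"

text \<open>The x^3 coefficient is solved from c^2 + 2 b d = 0: modulo 11, - 1/2 is 5 and d^9 is
  1/d, whence d runs over nonzero residues only.\<close>

lemma z11_check:
  "list_all (\<lambda>c. list_all (\<lambda>d. 
     distinct (map (horner6 z11_add z11_mul 0 0 ((5 * c^2 * d^9) mod 11) c d) z11_elems) \<longleftrightarrow>
     c = 0 \<and> d \<in> {2, 4, 7, 9} \<or> d \<in> {5, 6} \<and> c \<in> {1, 3, 4, 5, 9} \<or> d \<in> {4, 7} \<and> c \<in> {2, 6, 7, 8, 10}) [1,2,3,4,5,6,7,8,9,10]) z11_elems"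
  by code_simp

section \<open>The fields with 9 and 27 elements\<close>

lemma of_trit_neg: "of_trit (trit_neg x) = (- of_trit x :: 'a :: comm_ring_1)"
  by (cases x) simp_all

lemma trit_add_Tz: "trit_add x Tz = x"
  by (cases x) simp_all

lemma trit_diff_eq_Tz: "trit_add x (trit_neg y) = Tz \<longleftrightarrow> x = y"
  by (cases x; cases y) simp_all

fun f9_eval :: "'a \<Rightarrow> trit \<times> trit \<Rightarrow> 'a :: comm_ring_1" where
  "f9_eval i (a, b) = of_trit a + of_trit b * i"

lemma set_f9_elems: "set f9_elems = UNIV"
  by (simp only: f9_elems_def set_product UNIV_trit[symmetric]) simp

text \<open>Every nonzero pair has an inverse by exhaustion, so its image is a unit; this yields
  injectivity, and counting yields surjectivity.\<close>

lemma f9_model: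
  fixes i :: "'a :: finite_field"
  assumes "CHAR('a) = 3" "CARD('a) = 9" "i^2 = - 1"
  shows "finite_field_model (f9_eval i) f9_elems f9_add f9_mul"
proof
  have add: "f9_eval i (f9_add x y) = f9_eval i x + f9_eval i y" for x y
    by (cases x; cases y) (simp add: of_trit_add[OF assms(1)] algebra_simps)
  have mul: "f9_eval i (f9_mul x y) = f9_eval i x * f9_eval i y" for x y
  proof (cases x; cases y)
    fix a b c d assume eq: "x = (a, b)" "y = (c, d)"
    show ?thesis
      unfolding eq f9_mul.simps f9_eval.simps of_trit_add[OF assms(1)] of_trit_mul of_trit_neg
      using assms(3) by algebra
  qed
  show "f9_eval i (f9_add x y) = f9_eval i x + f9_eval i y"
    "f9_eval i (f9_mul x y) = f9_eval i x * f9_eval i y" for x y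
    by (fact add, fact mul)
  have nz: "x = (Tz, Tz)" if "f9_eval i x = 0" for x
  proof (rule ccontr)
    assume "x \<noteq> (Tz, Tz)"
    then obtain y where "f9_mul x y = (Tp, Tz)"
      using f9_check_inverse unfolding list_all_iff list_ex_iff set_f9_elems by blast
    hence "f9_eval i x * f9_eval i y = 1" by (simp flip: mul)
    with that show False by simp
  qed
  have inj: "inj (f9_eval i)"
  proof (rule injI)
    fix x y assume eq: "f9_eval i x = f9_eval i y"
    obtain a b c d where xy: "x = (a, b)" "y = (c, d)" by (metis surj_pair)
    have "f9_eval i (f9_add x (f9_mul (Tm, Tz) y)) = 0"
      using eq by (simp only: add mul) simp
    from nz[OF this] show "x = y" by (simp add: xy trit_add_Tz trit_diff_eq_Tz)
  qed
  have "card (f9_eval i ` UNIV) = CARD(trit \<times> trit)" using inj by (rule card_image)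
  also have "\<dots> = card (set f9_elems)" by (simp only: set_f9_elems)
  also have "\<dots> = CARD('a)"
    unfolding assms(2) by (simp add: f9_elems_def)
  finally have "surj (f9_eval i)" by (intro card_subset_eq) auto
  with inj show "bij_betw (f9_eval i) (set f9_elems) UNIV"
    by (simp add: set_f9_elems bij_def)
qed (simp_all add: set_f9_elems, simp add: f9_elems_def)

fun f27_eval :: "'a \<Rightarrow> trit \<times> trit \<times> trit \<Rightarrow> 'a :: comm_ring_1" where
  "f27_eval \<theta> (a, b, c) = of_trit a + of_trit b * \<theta> + of_trit c * \<theta>^2"

lemma set_f27_elems: "set f27_elems = UNIV"
  by (simp only: f27_elems_def set_product UNIV_trit[symmetric]) simp

lemma f27_model:
  fixes \<theta> :: "'a :: finite_field"
  assumes "CHAR('a) = 3" "CARD('a) = 27" "\<theta>^3 = \<theta> + 1"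
  shows "finite_field_model (f27_eval \<theta>) f27_elems f27_add f27_mul"
proof
  have add: "f27_eval \<theta> (f27_add x y) = f27_eval \<theta> x + f27_eval \<theta> y" for x y
    by (cases x; cases y) (simp add: of_trit_add[OF assms(1)] algebra_simps)
  have mul: "f27_eval \<theta> (f27_mul x y) = f27_eval \<theta> x * f27_eval \<theta> y" for x y
  proof (cases x; cases y)
    fix a b c a' b' c' assume eq: "x = (a, b, c)" "y = (a', b', c')"
    show ?thesis
      unfolding eq f27_mul.simps Let_def f27_eval.simps of_trit_add[OF assms(1)] of_trit_mul of_trit_neg
      using assms(3) by algebra
  qed
  show "f27_eval \<theta> (f27_add x y) = f27_eval \<theta> x + f27_eval \<theta> y"
    "f27_eval \<theta> (f27_mul x y) = f27_eval \<theta> x * f27_eval \<theta> y" for x y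
    by (fact add, fact mul)
  have nz: "x = (Tz, Tz, Tz)" if "f27_eval \<theta> x = 0" for x
  proof (rule ccontr)
    assume "x \<noteq> (Tz, Tz, Tz)"
    then obtain y where "f27_mul x y = (Tp, Tz, Tz)"
      using f27_check_inverse unfolding list_all_iff list_ex_iff set_f27_elems by blast
    hence "f27_eval \<theta> x * f27_eval \<theta> y = 1" by (simp flip: mul)
    with that show False by simp
  qed
  have inj: "inj (f27_eval \<theta>)"
  proof (rule injI)
    fix x y assume eq: "f27_eval \<theta> x = f27_eval \<theta> y"
    obtain a b c a' b' c' where xy: "x = (a, b, c)" "y = (a', b', c')" by (metis surj_pair)
    have "f27_eval \<theta> (f27_add x (f27_mul (Tm, Tz, Tz) y)) = 0"
      using eq by (simp only: add mul) simp
    from nz[OF this] show "x = y" by (simp add: xy trit_add_Tz trit_diff_eq_Tz)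
  qed
  have "card (f27_eval \<theta> ` UNIV) = CARD(trit \<times> trit \<times> trit)" using inj by (rule card_image)
  also have "\<dots> = card (set f27_elems)" by (simp only: set_f27_elems)
  also have "\<dots> = CARD('a)"
    unfolding assms(2) by (simp add: f27_elems_def)
  finally have "surj (f27_eval \<theta>)" by (intro card_subset_eq) auto
  with inj show "bij_betw (f27_eval \<theta>) (set f27_elems) UNIV"
    by (simp add: set_f27_elems bij_def)
qed (simp_all add: set_f27_elems, simp add: f27_elems_def)

lemma sqrt_minus_1_exists:
  assumes "CARD('a :: finite_field) = 9"
  obtains i :: "'a :: finite_field" where "i^2 = - 1"
proof -
  obtain y :: 'a where y: "y \<noteq> 0" "y ^ 4 \<noteq> 1"
    using exists_power_neq_1[of 4, where 'a = 'a] assms by auto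
  have "y ^ 8 = 1" using finite_field_power_minus_1[OF y(1)] assms by simp
  hence "(y ^ 4 - 1) * (y ^ 4 + 1) = 0" by algebra
  with y have "(y^2)^2 = - 1" by (simp add: add_eq_0_iff2)
  thus ?thesis by (rule that)
qed

text \<open>Additive Hilbert 90: an element of trace \<open>s \<noteq> 0\<close> yields a solution of \<open>x^3 - x = - s\<close>.\<close>
lemma artin_schreier_root_exists:
  assumes char: "CHAR('a :: finite_field) = 3" and card: "CARD('a :: finite_field) = 27"
  obtains \<theta> :: "'a :: finite_field" where "\<theta>^3 = \<theta> + 1"
proof -
  have cube: "(x + y) ^ 3 = x ^ 3 + y ^ 3" for x y :: 'a
    by (rule freshmans_dream) (simp_all only: char CHAR_prime[where 'a = 'a, unfolded char])
  \<comment> \<open>The trace polynomial y + y^3 + y^9; its degree is below 27, so some element has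
    nonzero trace.\<close>
  let ?p = "[:0, 1, 0, 1, 0, 0, 0, 0, 0, 1:] :: 'a poly"
  have "card {y. poly ?p y = 0} \<le> 9"
    using card_poly_roots_bound[of ?p] by simp
  hence "{y. poly ?p y = 0} \<noteq> UNIV" using card by auto
  then obtain y where "poly ?p y \<noteq> 0" by auto
  define s where "s = y + y ^ 3 + y ^ 9"
  have "poly ?p y = s" by (simp add: s_def algebra_simps eval_nat_numeral)
  with \<open>poly ?p y \<noteq> 0\<close> have "s \<noteq> 0" by (simp only: not_False_eq_True)
  have "(y ^ 9) ^ 3 = y ^ (9 * 3)" by (simp only: power_mult)
  also have "\<dots> = y ^ 27" by simp
  also have "\<dots> = y ^ CARD('a)" by (simp only: card)
  also have "\<dots> = y" by (rule finite_field_power_card_eq_same)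
  finally have y27: "(y ^ 9) ^ 3 = y" .
  have y9: "(y ^ 3) ^ 3 = y ^ 9" by (simp add: power_mult[symmetric])
  have "s ^ 3 = s" unfolding s_def cube y9 y27 by (simp add: add_ac)
  hence s1: "s ^ 2 = 1" using \<open>s \<noteq> 0\<close> by (simp add: power3_eq_cube power2_eq_square)
  \<comment> \<open>Cubing cycles y, y^3, y^9, so weights 2, 1, 0 on y^9, y^3, y make x^3 - x
    telescope to - s modulo 3. The sum is written without numerals to suit
    \<open>cube\<close>.\<close>
  define x where "x = y ^ 9 + y ^ 9 + y ^ 3"
  have x3: "x ^ 3 = y + y + y ^ 9" unfolding x_def cube y9 y27 ..
  have "x ^ 3 = x + (s + s)"
    by (rule eq_char_3I[OF char, where w = "- (y ^ 3) - y ^ 9"]) (simp add: x3, simp add: x_def s_def)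
  \<comment> \<open>s is 1 or - 1, so multiplying by s normalises the right-hand side to a
    constant.\<close>
  moreover have "(s * x) ^ 3 = s * x ^ 3" using s1 by algebra
  ultimately have "(s * x) ^ 3 = s * x + (1 + 1)" using s1 by algebra
  hence "(- (s * x)) ^ 3 = - (s * x) + 1"
    using two_eq_minus_1[OF char] by simp
  thus ?thesis by (rule that)
qed

text \<open>Since 2 = - 1, the roots written 2^(1/2) are i and - i of the model.\<close>

lemma square_eq_2_iff:
  fixes i s :: "'a :: idom"
  assumes "CHAR('a) = 3" "i^2 = - 1"
  shows "s^2 = 2 \<longleftrightarrow> s = i \<or> s = - i"
proof -
  have "s^2 - 2 = (s - i) * (s + i) - 3"
    using assms(2) by algebra
  hence "s^2 = 2 \<longleftrightarrow> (s - i) * (s + i) = 0"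
    by (simp only: three_eq_0[OF assms(1)]) (metis diff_zero right_minus_eq)
  thus ?thesis by (auto simp: add_eq_0_iff2)
qed

lemma inj_sextic_card9_a_1:
  fixes c d e :: "'a :: finite_field"
  assumes char: "CHAR('a) = 3" and card: "CARD('a) = 9"
  shows "inj (poly (sextic 1 0 c d e)) \<longleftrightarrow> d = - c \<and>
    (c = 1 \<and> e = - 1 \<or>
     (\<exists>s. s^2 = 2 \<and> (c \<in> {1 - s, - (1 - s)} \<and> e = s \<or> c = - 1 \<and> e = - 1 + s)))"
proof -
  obtain i :: 'a where i: "i^2 = - 1" using sqrt_minus_1_exists[OF card] .
  interpret finite_field_model "f9_eval i" f9_elems f9_add f9_mul
    using f9_model[OF char card i] .
  have d: "d = - c" if "inj (poly (sextic 1 0 c d e))"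
  proof -
    have "2 * d + 2 * c = 0"
      using hermite_char3_drop_4[OF char that, of 0] card by simp
    hence "d = - c + 3 * (d + c)" by algebra
    thus ?thesis by (rule eq_char_3I[OF char])
  qed
  obtain c' e' where c: "c = f9_eval i c'" and e: "e = f9_eval i e'"
    using obtain_rep by metis
  have "inj (poly (sextic 1 0 c (- c) e)) \<longleftrightarrow>
      inj (poly (sextic (f9_eval i (Tp, Tz)) (f9_eval i (Tz, Tz)) (f9_eval i c')
        (f9_eval i (f9_mul (Tm, Tz) c')) (f9_eval i e')))"
    unfolding h_mul by (simp add: c e)
  also have "\<dots> \<longleftrightarrow> distinct (map (horner6 f9_add f9_mul (Tp, Tz) (Tz, Tz) c' (f9_mul (Tm, Tz) c') e') f9_elems)"
    by (rule inj_sextic_iff) (simp_all add: set_f9_elems)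
  also have "\<dots> \<longleftrightarrow> (c', e') \<in> set [((Tp, Tz), (Tm, Tz)), ((Tp, Tm), (Tz, Tp)), ((Tm, Tp), (Tz, Tp)), ((Tm, Tz), (Tm, Tp)),
       ((Tp, Tp), (Tz, Tm)), ((Tm, Tm), (Tz, Tm)), ((Tm, Tz), (Tm, Tm))]"
    by (rule f9_check_1[unfolded list_all_iff set_f9_elems, THEN bspec, THEN bspec, OF UNIV_I UNIV_I])
  also have "\<dots> \<longleftrightarrow> (c, e) \<in> {(1, - 1), (1 - i, i), (- 1 + i, i), (- 1, - 1 + i),
      (1 + i, - i), (- 1 - i, - i), (- 1, - 1 - i)}"
  proof -
    have "inj (map_prod (f9_eval i) (f9_eval i))"
      using bij unfolding bij_betw_def set_f9_elems by (intro prod.inj_map) auto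
    note * = inj_image_mem_iff[OF this, of "(c', e')", symmetric]
    show ?thesis by (subst *) (simp add: c e)
  qed
  finally have iff: "inj (poly (sextic 1 0 c (- c) e)) \<longleftrightarrow> (c, e) \<in> {(1, - 1), (1 - i, i), (- 1 + i, i),
      (- 1, - 1 + i), (1 + i, - i), (- 1 - i, - i), (- 1, - 1 - i)}" .
  \<comment> \<open>Each root s accounts for three pairs; the seventh, (1, - 1), is independent of
    the root.\<close>
  define Q where "Q s \<longleftrightarrow> c \<in> {1 - s, - (1 - s)} \<and> e = s \<or> c = - 1 \<and> e = - 1 + s" for s
  have "(\<exists>s. s^2 = 2 \<and> Q s) \<longleftrightarrow> Q i \<or> Q (- i)"
    unfolding square_eq_2_iff[OF char i] by blast
  moreover have "Q i \<longleftrightarrow> (c, e) \<in> {(1 - i, i), (- 1 + i, i), (- 1, - 1 + i)}"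
    "Q (- i) \<longleftrightarrow> (c, e) \<in> {(1 + i, - i), (- 1 - i, - i), (- 1, - 1 - i)}"
    by (auto simp: Q_def)
  ultimately have "(c, e) \<in> {(1, - 1), (1 - i, i), (- 1 + i, i), (- 1, - 1 + i), (1 + i, - i), (- 1 - i, - i), (- 1, - 1 - i)}
      \<longleftrightarrow> c = 1 \<and> e = - 1 \<or> (\<exists>s. s^2 = 2 \<and> Q s)"
    by simp
  note iff = iff[unfolded this Q_def]
  show ?thesis
  proof (cases "d = - c")
    case True
    show ?thesis unfolding True iff by (simp only: simp_thms)
  next
    case False
    thus ?thesis using d by (simp only: simp_thms) (rule notI, blast)
  qed
qed

text \<open>The sign r stands for a^4: scaling by a turns the coefficients a^7 b and a (2 b + 1)
  into a^4 b and a^4 (2 b + 1), as a^8 = 1.\<close>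

lemma inj_sextic_card9_a_0:
  fixes c e :: "'a :: finite_field"
  assumes char: "CHAR('a) = 3" and card: "CARD('a) = 9"
  shows "inj (poly (sextic 0 1 c 1 e)) \<longleftrightarrow>
    (\<exists>r \<in> {1, - 1}. \<exists>s. s^2 = 2 \<and> (\<exists>\<beta> \<in> {0, 1, s, 1 + s}. c = r * \<beta> \<and> e = r * (2 * \<beta> + 1)))"
proof -
  obtain i :: 'a where i: "i^2 = - 1" using sqrt_minus_1_exists[OF card] .
  interpret finite_field_model "f9_eval i" f9_elems f9_add f9_mul
    using f9_model[OF char card i] .
  obtain c' e' where c: "c = f9_eval i c'" and e: "e = f9_eval i e'"
    using obtain_rep by metis
  have "inj (poly (sextic 0 1 c 1 e)) \<longleftrightarrow>
      inj (poly (sextic (f9_eval i (Tz, Tz)) (f9_eval i (Tp, Tz)) (f9_eval i c')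
        (f9_eval i (Tp, Tz)) (f9_eval i e')))"
    by (simp add: c e)
  also have "\<dots> \<longleftrightarrow> distinct (map (horner6 f9_add f9_mul (Tz, Tz) (Tp, Tz) c' (Tp, Tz) e') f9_elems)"
    by (rule inj_sextic_iff) (simp_all add: set_f9_elems)
  also have "\<dots> \<longleftrightarrow> (c', e') \<in> set [((Tz, Tz), (Tp, Tz)), ((Tz, Tz), (Tm, Tz)), ((Tp, Tz), (Tz, Tz)), ((Tm, Tz), (Tz, Tz)),
       ((Tz, Tp), (Tp, Tm)), ((Tz, Tm), (Tm, Tp)), ((Tz, Tm), (Tp, Tp)), ((Tz, Tp), (Tm, Tm)),
       ((Tp, Tp), (Tz, Tm)), ((Tm, Tm), (Tz, Tp)), ((Tp, Tm), (Tz, Tp)), ((Tm, Tp), (Tz, Tm))]"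
    by (rule f9_check_0[unfolded list_all_iff set_f9_elems, THEN bspec, THEN bspec, OF UNIV_I UNIV_I])
  also have "\<dots> \<longleftrightarrow> (c, e) \<in> {(0, 1), (0, - 1), (1, 0), (- 1, 0),
      (i, 1 - i), (- i, - 1 + i), (- i, 1 + i), (i, - 1 - i),
      (1 + i, - i), (- 1 - i, i), (1 - i, i), (- 1 + i, - i)}"
  proof -
    have "inj (map_prod (f9_eval i) (f9_eval i))"
      using bij unfolding bij_betw_def set_f9_elems by (intro prod.inj_map) auto
    note * = inj_image_mem_iff[OF this, of "(c', e')", symmetric]
    show ?thesis by (subst *) (simp add: c e)
  qed
  also have "\<dots> \<longleftrightarrow> (\<exists>r \<in> {1, - 1}. \<exists>s. s^2 = 2 \<and> (\<exists>\<beta> \<in> {0, 1, s, 1 + s}. c = r * \<beta> \<and> e = r * (2 * \<beta> + 1)))"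
  proof -
    define Q where "Q s \<longleftrightarrow> (\<exists>r \<in> {1, - 1}. \<exists>\<beta> \<in> {0, 1, s, 1 + s}. c = r * \<beta> \<and> e = r * (2 * \<beta> + 1))" for s :: 'a
    have Q: "Q s \<longleftrightarrow> (c, e) \<in> {(0, 1), (0, - 1), (1, 0), (- 1, 0),
        (s, 1 - s), (- s, - 1 + s), (1 + s, - s), (- 1 - s, s)}" for s
      unfolding Q_def two_eq_minus_1[OF char] by auto
    have "(c, e) \<in> {(0, 1), (0, - 1), (1, 0), (- 1, 0), (i, 1 - i), (- i, - 1 + i), (- i, 1 + i), (i, - 1 - i),
        (1 + i, - i), (- 1 - i, i), (1 - i, i), (- 1 + i, - i)} \<longleftrightarrow> Q i \<or> Q (- i)"
      unfolding Q Un_iff[symmetric] by (rule arg_cong[where f = "\<lambda>A. (c, e) \<in> A"]) auto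
    also have "\<dots> \<longleftrightarrow> (\<exists>s. s^2 = 2 \<and> Q s)"
      unfolding square_eq_2_iff[OF char i] by blast
    also have "\<dots> \<longleftrightarrow> (\<exists>r \<in> {1, - 1}. \<exists>s. s^2 = 2 \<and> (\<exists>\<beta> \<in> {0, 1, s, 1 + s}. c = r * \<beta> \<and> e = r * (2 * \<beta> + 1)))"
      by (simp only: Q_def bex_simps conj_commute ex_comm Bex_def) metis
    finally show ?thesis .
  qed
  finally show ?thesis .
qed

lemma not_inj_sextic_card9_nonsquare:
  fixes b c e :: "'a :: finite_field"
  assumes char: "CHAR('a) = 3" and card: "CARD('a) = 9" and b: "\<not> is_square b"
  shows "\<not> inj (poly (sextic 0 b c (b^2) e))"
proof -
  obtain i :: 'a where i: "i^2 = - 1" using sqrt_minus_1_exists[OF card] .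
  interpret finite_field_model "f9_eval i" f9_elems f9_add f9_mul
    using f9_model[OF char card i] .
  have *: "\<not> inj (poly (sextic 0 (1 + i) c ((1 + i)^2) e))" for c e
  proof -
    obtain c' e' where c: "c = f9_eval i c'" and e: "e = f9_eval i e'"
      using obtain_rep by metis
    have "inj (poly (sextic 0 (1 + i) c ((1 + i)^2) e)) \<longleftrightarrow>
        inj (poly (sextic (f9_eval i (Tz, Tz)) (f9_eval i (Tp, Tp)) (f9_eval i c')
          (f9_eval i (f9_mul (Tp, Tp) (Tp, Tp))) (f9_eval i e')))"
      unfolding h_mul by (simp add: c e power2_eq_square)
    also have "\<dots> \<longleftrightarrow> distinct (map (horner6 f9_add f9_mul (Tz, Tz) (Tp, Tp) c' (f9_mul (Tp, Tp) (Tp, Tp)) e') f9_elems)"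
      by (rule inj_sextic_iff) (simp_all add: set_f9_elems)
    finally show ?thesis
      using f9_check_nonsquare[unfolded list_all_iff set_f9_elems, THEN bspec, THEN bspec, OF UNIV_I UNIV_I]
      by blast
  qed
  obtain b' where b': "b = f9_eval i b'" using obtain_rep by metis
  have "b \<noteq> 0" using b by auto
  hence "b' \<noteq> (Tz, Tz)" unfolding b' by auto
  then obtain u' where "b' = f9_mul u' u' \<or> b' = f9_mul (Tp, Tp) (f9_mul u' u')"
    using f9_check_square_classes unfolding list_all_iff list_ex_iff set_f9_elems by blast
  moreover have "b' \<noteq> f9_mul u' u'"
    using b unfolding b' by (metis h_mul power2_eq_square is_nth_powerI)
  ultimately have "b = (1 + i) * (f9_eval i u')^2"
    unfolding b' by (auto simp only: h_mul) (simp add: power2_eq_square)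
  then obtain u where u: "b = u^2 * (1 + i)" by (metis mult.commute)
  with \<open>b \<noteq> 0\<close> have "u \<noteq> 0" by auto
  have "sextic 0 b c (b^2) e = sextic (u * 0) (u^2 * (1 + i)) (u^3 * (c / u^3)) (u^4 * (1 + i)^2) (u^5 * (e / u^5))"
    using \<open>u \<noteq> 0\<close> by (simp add: u power_mult_distrib flip: power_mult)
  hence "inj (poly (sextic 0 b c (b^2) e)) \<longleftrightarrow> inj (poly (sextic 0 (1 + i) (c / u^3) ((1 + i)^2) (e / u^5)))"
    by (simp only: inj_sextic_scale[OF \<open>u \<noteq> 0\<close>])
  with * show ?thesis by (simp only: not_False_eq_True)
qed

lemma inj_sextic_card27_a_1:
  fixes c d e :: "'a :: finite_field"
  assumes char: "CHAR('a) = 3" and card: "CARD('a) = 27"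
  shows "inj (poly (sextic 1 0 c d e)) \<longleftrightarrow> c = 0 \<and> d = 2 \<and> e = 0"
proof -
  obtain \<theta> :: 'a where \<theta>: "\<theta>^3 = \<theta> + 1" using artin_schreier_root_exists[OF char card] .
  interpret finite_field_model "f27_eval \<theta>" f27_elems f27_add f27_mul
    using f27_model[OF char card \<theta>] .
  note two = two_eq_minus_1[OF char]
  obtain d' where d: "d = f27_eval \<theta> d'"
    using obtain_rep by metis
  have ce: "c = - d - 1 \<and> e = (d ^ 3) ^ 3 - d" if inj: "inj (poly (sextic 1 0 c d e))"
  proof -
    have "2 * d + 2 * c + 2 = 0"
      using hermite_char3_drop_4[OF char inj, of 1] card by simp
    hence "c = - d - 1 + 3 * (c + d + 1)" by algebra
    hence c: "c = - d - 1" by (rule eq_char_3I[OF char])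
    have "d * (2 * d + 2 * c) ^ 3 + (2 * e + 2 * d) ^ 3 = 0"
      using hermite_char3_drop_16[OF char inj, of 0] card by simp
    hence "d = (e + d) ^ 3" unfolding c by (simp add: two power3_eq_cube algebra_simps)
    \<comment> \<open>The ninth power inverts cubing in a field of 27 elements, which solves for
      e.\<close>
    hence "(d ^ 3) ^ 3 = (((e + d) ^ 3) ^ 3) ^ 3"
      by (rule arg_cong[where f = "\<lambda>x. (x ^ 3) ^ 3"])
    also have "\<dots> = (e + d) ^ 27" by simp
    also have "\<dots> = (e + d) ^ CARD('a)" by (simp only: card)
    also have "\<dots> = e + d" by (rule finite_field_power_card_eq_same)
    finally show ?thesis using c by simp
  qed
  have neg: "f27_eval \<theta> (f27_neg x) = - f27_eval \<theta> x" for x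
    unfolding f27_neg_def h_mul by simp
  have cube: "f27_eval \<theta> (f27_cube x) = f27_eval \<theta> x ^ 3" for x
    unfolding f27_cube_def h_mul by (simp add: power3_eq_cube)
  have "inj (poly (sextic 1 0 (- d - 1) d ((d ^ 3) ^ 3 - d))) \<longleftrightarrow>
      inj (poly (sextic (f27_eval \<theta> (Tp, Tz, Tz)) (f27_eval \<theta> (Tz, Tz, Tz))
        (f27_eval \<theta> (f27_neg (f27_add d' (Tp, Tz, Tz)))) (f27_eval \<theta> d')
        (f27_eval \<theta> (f27_add (f27_cube (f27_cube d')) (f27_neg d')))))"
    unfolding neg h_add cube d[symmetric] by simp
  also have "\<dots> \<longleftrightarrow> distinct (map (horner6 f27_add f27_mul (Tp, Tz, Tz) (Tz, Tz, Tz) (f27_neg (f27_add d' (Tp, Tz, Tz))) d'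
       (f27_add (f27_cube (f27_cube d')) (f27_neg d'))) f27_elems)"
    by (rule inj_sextic_iff) (simp_all add: set_f27_elems)
  also have "\<dots> \<longleftrightarrow> d' = (Tm, Tz, Tz)"
    using f27_check_1 unfolding list_all_iff set_f27_elems by blast
  also have "\<dots> \<longleftrightarrow> f27_eval \<theta> d' = f27_eval \<theta> (Tm, Tz, Tz)"
    using bij unfolding bij_betw_def set_f27_elems by (metis inj_eq)
  also have "\<dots> \<longleftrightarrow> d = 2" by (simp add: d two)
  finally have iff: "inj (poly (sextic 1 0 (- d - 1) d ((d ^ 3) ^ 3 - d))) \<longleftrightarrow> d = 2" .
  show ?thesis
  proof
    assume inj: "inj (poly (sextic 1 0 c d e))"
    with iff ce[OF inj] have "d = 2" by simp
    with ce[OF inj] show "c = 0 \<and> d = 2 \<and> e = 0" by (simp add: two)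
  next
    assume "c = 0 \<and> d = 2 \<and> e = 0"
    with iff show "inj (poly (sextic 1 0 c d e))" by (simp add: two)
  qed
qed

section \<open>The field with 11 elements\<close>

lemma of_int_mod_11:
  assumes "(11 :: 'a :: comm_ring_1) = 0"
  shows "of_int (k mod 11) = (of_int k :: 'a)"
proof -
  have "of_int k = (of_int (11 * (k div 11) + k mod 11) :: 'a)" by simp
  also have "\<dots> = of_int (k mod 11)" unfolding of_int_add of_int_mult using assms by simp
  finally show ?thesis ..
qed

lemma set_z11_elems: "set z11_elems = {0..10}"
  unfolding z11_elems_def by (auto; presburger)

lemma mod_11_in_z11_elems: "k mod 11 \<in> set z11_elems"
  unfolding set_z11_elems using pos_mod_bound[of 11 k] by simp

lemma z11_model:
  assumes "CARD('a :: finite_field) = 11"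
  shows "finite_field_model (of_int :: int \<Rightarrow> 'a) z11_elems z11_add z11_mul"
proof
  have char: "CHAR('a) = 11" using CHAR_eq_prime_base[where 'a = 'a, of 11 1] assms by simp
  have eleven: "(11 :: 'a) = 0" using of_nat_CARD_eq_0[where 'a = 'a] by (simp add: assms)
  have inj: "inj_on (of_int :: int \<Rightarrow> 'a) (set z11_elems)"
  proof (rule inj_onI)
    fix x y :: int assume xy: "x \<in> set z11_elems" "y \<in> set z11_elems" "of_int x = (of_int y :: 'a)"
    hence "of_int (x - y) = (0 :: 'a)" by simp
    hence "int 11 dvd x - y" by (simp only: of_int_eq_0_iff_char_dvd char)
    with xy show "x = y" unfolding set_z11_elems by (simp, presburger)
  qed
  moreover have "card ((of_int :: int \<Rightarrow> 'a) ` set z11_elems) = CARD('a)"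
    unfolding assms card_image[OF inj] by (simp add: z11_elems_def)
  hence "(of_int :: int \<Rightarrow> 'a) ` set z11_elems = UNIV" by (intro card_subset_eq) auto
  ultimately show "bij_betw (of_int :: int \<Rightarrow> 'a) (set z11_elems) UNIV" by (simp add: bij_betw_def)
  show "distinct z11_elems" by (simp add: z11_elems_def)
  show "z11_add x y \<in> set z11_elems" "z11_mul x y \<in> set z11_elems" for x y
    unfolding z11_add_def z11_mul_def by (rule mod_11_in_z11_elems)+
  show "of_int (z11_add x y) = (of_int x + of_int y :: 'a)" for x y
    by (simp add: z11_add_def of_int_mod_11[OF eleven])
  show "of_int (z11_mul x y) = (of_int x * of_int y :: 'a)" for x y
    by (simp add: z11_mul_def of_int_mod_11[OF eleven])
qed

lemma z11_squares:
  "list_all (\<lambda>c. list_ex (\<lambda>y. c = z11_mul y y) z11_elems \<longleftrightarrow> c = 0 \<or> c \<in> {1, 3, 4, 5, 9}) z11_elems"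
  by code_simp

lemma inj_sextic_card11:
  fixes a b c d :: "'a :: finite_field"
  assumes card: "CARD('a) = 11"
  shows "inj (poly (sextic 0 a b c d)) \<longleftrightarrow> a = 0 \<and> (\<exists>r \<in> {1, - 1}.
    b = 0 \<and> c = 0 \<and> d \<in> {r * 2, r * 4} \<or>
    c \<noteq> 0 \<and> is_square c \<and> b = r * c^2 \<and> d = r * 5 \<or>
    \<not> is_square c \<and> b = r * (4 * c^2) \<and> d = r * 4)" (is "_ \<longleftrightarrow> a = 0 \<and> ?R")
proof -
  interpret finite_field_model "of_int :: int \<Rightarrow> 'a" z11_elems z11_add z11_mul
    using z11_model[OF card] .
  have eleven: "(11 :: 'a) = 0" using of_nat_CARD_eq_0[where 'a = 'a] by (simp add: card)
  note mod11 = of_int_mod_11[OF eleven]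
  have eq_iff: "of_int x = (of_int y :: 'a) \<longleftrightarrow> x = y" if "x \<in> set z11_elems" "y \<in> set z11_elems" for x y
    using bij that unfolding bij_betw_def by (meson inj_on_eq_iff)
  obtain c' where c': "c' \<in> set z11_elems" "c = of_int c'" using obtain_rep .
  obtain d' where d': "d' \<in> set z11_elems" "d = of_int d'" using obtain_rep .
  have nz: "(of_int k :: 'a) \<noteq> 0" if "k \<in> set z11_elems" "k \<noteq> 0" for k
    using eq_iff[of k 0] that by (simp add: z11_elems_def)
  have nonzero: "(2 :: 'a) \<noteq> 0" "(4 :: 'a) \<noteq> 0" "(5 :: 'a) \<noteq> 0"
    using nz[of 2] nz[of 4] nz[of 5] by (simp_all add: z11_elems_def)
  have sq: "is_square c \<longleftrightarrow> c' = 0 \<or> c' \<in> {1, 3, 4, 5, 9}"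
  proof -
    have "is_square c \<longleftrightarrow> (\<exists>y \<in> set z11_elems. c = of_int y ^ 2)"
      unfolding is_nth_power_def using obtain_rep by metis
    also have "\<dots> \<longleftrightarrow> (\<exists>y \<in> set z11_elems. of_int c' = (of_int (z11_mul y y) :: 'a))"
      by (simp add: c'(2) h_mul power2_eq_square)
    also have "\<dots> \<longleftrightarrow> (\<exists>y \<in> set z11_elems. c' = z11_mul y y)"
      using eq_iff c'(1) mul_closed by blast
    finally show ?thesis
      using z11_squares c'(1) unfolding list_all_iff list_ex_iff by blast
  qed
  have neg: "- 2 = (of_int 9 :: 'a)" "- 4 = (of_int 7 :: 'a)" "- 5 = (of_int 6 :: 'a)"
    using eleven by (simp_all add: neg_eq_iff_add_eq_0)
  have "d \<in> {2, - 2} \<longleftrightarrow> d' \<in> {2, 9}" "d \<in> {4, - 4} \<longleftrightarrow> d' \<in> {4, 7}" "d \<in> {5, - 5} \<longleftrightarrow> d' \<in> {5, 6}"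
    "c = 0 \<longleftrightarrow> c' = 0"
    unfolding neg c' d'
    using eq_iff[OF d'(1), of 2] eq_iff[OF d'(1), of 9] eq_iff[OF d'(1), of 4] eq_iff[OF d'(1), of 7]
      eq_iff[OF d'(1), of 5] eq_iff[OF d'(1), of 6] eq_iff[OF c'(1), of 0]
    by (simp_all add: z11_elems_def)
  note d_iff = this
  have inj_iff: "inj (poly (sextic 0 0 (5 * c^2 * d^9) c d)) \<longleftrightarrow>
      c = 0 \<and> d \<in> {2, - 2, 4, - 4} \<or> d \<in> {5, - 5} \<and> c \<noteq> 0 \<and> is_square c \<or> d \<in> {4, - 4} \<and> \<not> is_square c"
    if "d \<noteq> 0"
  proof -
    have "inj (poly (sextic 0 0 (5 * c^2 * d^9) c d)) \<longleftrightarrow>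
        inj (poly (sextic (of_int 0) (of_int 0) (of_int ((5 * c'^2 * d'^9) mod 11)) (of_int c') (of_int d' :: 'a)))"
      unfolding mod11 by (simp add: c' d')
    also have "\<dots> \<longleftrightarrow> distinct (map (horner6 z11_add z11_mul 0 0 ((5 * c'^2 * d'^9) mod 11) c' d') z11_elems)"
      by (rule inj_sextic_iff[OF _ _ mod_11_in_z11_elems c'(1) d'(1)]) (simp_all add: z11_elems_def)
    also have "\<dots> \<longleftrightarrow> c' = 0 \<and> d' \<in> {2, 4, 7, 9} \<or> d' \<in> {5, 6} \<and> c' \<in> {1, 3, 4, 5, 9} \<or>
        d' \<in> {4, 7} \<and> c' \<in> {2, 6, 7, 8, 10}"
    proof -
      have "d' \<in> set [1,2,3,4,5,6,7,8,9,10]" using d' that by (auto simp: z11_elems_def)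
      from z11_check[unfolded list_all_iff, THEN bspec, THEN bspec, OF c'(1) this] show ?thesis .
    qed
    also have "\<dots> \<longleftrightarrow> c' = 0 \<and> (d' \<in> {2, 9} \<or> d' \<in> {4, 7}) \<or> d' \<in> {5, 6} \<and> c' \<noteq> 0 \<and> (c' = 0 \<or> c' \<in> {1, 3, 4, 5, 9}) \<or>
        d' \<in> {4, 7} \<and> \<not> (c' = 0 \<or> c' \<in> {1, 3, 4, 5, 9})"
    proof -
      have "c' \<in> {2, 6, 7, 8, 10} \<longleftrightarrow> \<not> (c' = 0 \<or> c' \<in> {1, 3, 4, 5, 9})"
        using c'(1) by (auto simp: z11_elems_def)
      moreover have "c' \<in> {1, 3, 4, 5, 9} \<longleftrightarrow> c' \<noteq> 0 \<and> (c' = 0 \<or> c' \<in> {1, 3, 4, 5, 9})"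
        by auto
      moreover have "d' \<in> {2, 4, 7, 9} \<longleftrightarrow> d' \<in> {2, 9} \<or> d' \<in> {4, 7}" by auto
      ultimately show ?thesis by argo
    qed
    finally show ?thesis unfolding sq[symmetric] unfolding d_iff[symmetric] by blast
  qed
  \<comment> \<open>These numbers are 5 * 5^9 and 5 * 4^9, the values of 5 d^9 at d = 5 and d =
    4.\<close>
  have "(9765625 :: 'a) = 1 + 11 * 887784" "(1310720 :: 'a) = 4 + 11 * 119156" by simp_all
  hence num: "(9765625 :: 'a) = 1" "(1310720 :: 'a) = 4" unfolding eleven by simp_all
  have b_eq: "5 * c^2 * d^9 = r * c^2" if "r \<in> {1, - 1}" "d = r * 5" for r
    using that by (auto simp: num)
  have b_eq': "5 * c^2 * d^9 = r * (4 * c^2)" if "r \<in> {1, - 1}" "d = r * 4" for r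
    using that by (auto simp: num)
  show ?thesis
  proof
    assume inj: "inj (poly (sextic 0 a b c d))"
    have a: "a = 0" and e: "c^2 + 2 * b * d = 0"
      using five_mod_six_conditions[OF inj] card CHAR_eq_prime_base[where 'a = 'a, of 11 1] by auto
    have "d \<noteq> 0"
    proof
      assume "d = 0"
      with e have "c = 0" by simp
      with \<open>d = 0\<close> a inj not_inj_sextic_b[of b] card show False by simp
    qed
    \<comment> \<open>Modulo 11, - 1/2 is 5; the multiple of 11 keeps the identity integral.\<close>
    have "b * d = 5 * c^2 + 11 * (b * d)"
      using e by algebra
    hence "b * d = 5 * c^2" by (simp only: eleven) simp
    hence "b * d ^ 10 = 5 * c^2 * d ^ 9" by algebra
    hence b: "b = 5 * c^2 * d^9"
      using finite_field_power_minus_1[OF \<open>d \<noteq> 0\<close>] card by simp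
    consider "c = 0" "d \<in> {2, - 2, 4, - 4}" | "d \<in> {5, - 5}" "c \<noteq> 0" "is_square c"
      | "d \<in> {4, - 4}" "\<not> is_square c"
      using inj inj_iff[OF \<open>d \<noteq> 0\<close>] unfolding a b by blast
    hence ?R
    proof cases
      case 1
      thus ?thesis by (auto simp: b)
    next
      case 2
      hence "\<exists>r \<in> {1, - 1}. d = r * 5" by simp
      then obtain r where "r \<in> {1, - 1}" "d = r * 5" ..
      thus ?thesis using 2 b_eq unfolding b by blast
    next
      case 3
      hence "\<exists>r \<in> {1, - 1}. d = r * 4" by simp
      then obtain r where "r \<in> {1, - 1}" "d = r * 4" ..
      thus ?thesis using 3 b_eq' unfolding b by blast
    qed
    with a show "a = 0 \<and> ?R" by blast
  next
    assume "a = 0 \<and> ?R"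
    then obtain r where "a = 0" and r: "r \<in> {1, - 1}" and R: "b = 0 \<and> c = 0 \<and> d \<in> {r * 2, r * 4} \<or>
      c \<noteq> 0 \<and> is_square c \<and> b = r * c^2 \<and> d = r * 5 \<or>
      \<not> is_square c \<and> b = r * (4 * c^2) \<and> d = r * 4" by blast
    have "d \<noteq> 0" using R r nonzero by auto
    moreover have "b = 5 * c^2 * d^9"
    proof -
      consider "b = 0" "c = 0" | "b = r * c^2" "d = r * 5" | "b = r * (4 * c^2)" "d = r * 4"
        using R by blast
      thus ?thesis
      proof cases
        case 1
        thus ?thesis by simp
      next
        case 2
        thus ?thesis using b_eq[OF r 2(2)] by (simp only:)
      next
        case 3
        thus ?thesis using b_eq'[OF r 3(2)] by (simp only:)
      qed
    qed
    moreover have "c = 0 \<and> d \<in> {2, - 2, 4, - 4} \<or> d \<in> {5, - 5} \<and> c \<noteq> 0 \<and> is_square c \<or> d \<in> {4, - 4} \<and> \<not> is_square c"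
      using R r by auto
    ultimately show "inj (poly (sextic 0 a b c d))"
      using inj_iff \<open>a = 0\<close> by simp
  qed
qed

section \<open>The classification\<close>

lemma permutation_poly_iff_inj: "permutation_poly f \<longleftrightarrow> inj (poly f)"
  unfolding permutation_poly_def bij_def using finite_UNIV_inj_surj[of "poly f"] by auto

text \<open>The only prime divisors of 6 are 2 and 3, so an x^5 term may survive just in
  characteristic 3.\<close>

lemma normalised_poly_iff_sextic:
  fixes f :: "'a :: finite_field poly"
  assumes "degree f = 6" "CHAR('a) \<noteq> 2"
  shows "normalised_poly f \<longleftrightarrow> (\<exists>a b c d e. f = sextic a b c d e \<and> (CHAR('a) = 3 \<or> a = 0))"
proof
  assume "normalised_poly f"
  hence f: "coeff f 6 = 1" "coeff f 0 = 0" "\<not> CHAR('a) dvd 6 \<longrightarrow> coeff f 5 = 0"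
    using assms(1) by (auto simp: normalised_poly_def poly_0_coeff_0)
  have eq: "f = sextic (coeff f 5) (coeff f 4) (coeff f 3) (coeff f 2) (coeff f 1)"
  proof (rule poly_eqI)
    fix n :: nat
    consider "n = 0" | "n = 1" | "n = 2" | "n = 3" | "n = 4" | "n = 5" | "n = 6" | "n > 6" by linarith
    thus "coeff f n = coeff (sextic (coeff f 5) (coeff f 4) (coeff f 3) (coeff f 2) (coeff f 1)) n"
    proof cases
      case 8
      thus ?thesis by (simp add: coeff_eq_0 assms(1))
    qed (use f in \<open>simp_all add: sextic_def eval_nat_numeral\<close>)
  qed
  have "CHAR('a) dvd 6 \<Longrightarrow> CHAR('a) = 3"
  proof -
    assume "CHAR('a) dvd 6"
    hence "CHAR('a) dvd 2 * 3" by simp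
    hence "CHAR('a) dvd 2 \<or> CHAR('a) dvd 3" by (simp only: prime_dvd_mult_iff[OF CHAR_prime])
    moreover have "prime (3 :: nat)" by simp
    ultimately show ?thesis
      using assms(2) by (metis CHAR_prime primes_dvd_imp_eq two_is_prime_nat)
  qed
  with f(3) eq show "\<exists>a b c d e. f = sextic a b c d e \<and> (CHAR('a) = 3 \<or> a = 0)" by blast
next
  assume "\<exists>a b c d e. f = sextic a b c d e \<and> (CHAR('a) = 3 \<or> a = 0)"
  then obtain a b c d e where f: "f = sextic a b c d e" "CHAR('a) = 3 \<or> a = 0" by blast
  have "lead_coeff f = 1" "poly f 0 = 0" "coeff f 5 = a"
    by (simp_all add: f(1) sextic_def eval_nat_numeral)
  with f(2) assms(1) show "normalised_poly f" by (auto simp: normalised_poly_def)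
qed

text \<open>Here D = 0, and the constant term of the reversed power is 1.\<close>

lemma not_inj_sextic_one_mod_six:
  fixes a b c d e :: "'a :: finite_field"
  assumes "CARD('a) mod 6 = 1" "CARD('a) \<ge> 7"
  shows "\<not> inj (poly (sextic a b c d e))"
proof
  assume inj: "inj (poly (sextic a b c d e))"
  define N where "N = (CARD('a) - 1) div 6"
  have "6 * N = CARD('a) - 1 + 0" "0 < N" using assms unfolding N_def by presburger+
  hence "coeff ([:1, a, b, c, d, e:] ^ N) 0 = 0"
    using assms by (intro hermite_sextic[OF inj]) auto
  thus False by (simp add: coeff_0_power)
qed

lemma inj_sextic_imp_card:
  fixes a b c d e :: "'a :: finite_field"
  assumes "primepow CARD('a)" "odd CARD('a)" "CARD('a) \<ge> 7"
    and inj: "inj (poly (sextic a b c d e))" and a: "CHAR('a) = 3 \<or> a = 0"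
  shows "CARD('a) = 9 \<and> CHAR('a) = 3 \<or> CARD('a) = 27 \<and> CHAR('a) = 3 \<or> CARD('a) = 11"
proof -
  obtain p k where pk: "prime p" "k > 0" "CARD('a) = p ^ k"
    using assms(1) by (auto simp: primepow_def)
  have char: "CHAR('a) = p" by (rule CHAR_eq_prime_base[OF pk(3,1)])
  have "p \<noteq> 2" using assms(2) pk by auto
  have three: "prime (3 :: nat)" by simp
  show ?thesis
  proof (cases "p = 3")
    case True
    have "k < 4" using not_inj_sextic_char3[of k a b c d e] inj char pk True by force
    hence "k \<in> {1, 2, 3}" using pk(2) by auto
    thus ?thesis using assms(3) pk(3) char True by auto
  next
    case False
    have "\<not> 3 dvd p ^ k" "\<not> 2 dvd p ^ k"
      using False \<open>p \<noteq> 2\<close> pk(1) by (metis prime_dvd_power primes_dvd_imp_eq two_is_prime_nat three)+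
    hence "CARD('a) mod 6 = 1 \<or> CARD('a) mod 6 = 5" unfolding pk(3) by presburger
    hence mod: "CARD('a) mod 6 = 5"
      using not_inj_sextic_one_mod_six[of a b c d e] inj assms(3) by blast
    have "\<not> 3 dvd p" "\<not> 2 dvd p"
      using False \<open>p \<noteq> 2\<close> pk(1) by (metis primes_dvd_imp_eq two_is_prime_nat three)+
    hence "p mod 6 = 1 \<or> p mod 6 = 5" by presburger
    \<comment> \<open>Residue 1 would pass to every power of p. The characteristic itself is thus 5
      modulo 6, which keeps 7, 13, 19 and 313 invertible.\<close>
    moreover have "p mod 6 \<noteq> 1"
    proof
      assume "p mod 6 = 1"
      hence "p ^ k mod 6 = 1" by (metis One_nat_def mod_less one_less_numeral_iff power_mod power_one semiring_norm(76))
      with mod pk show False by simp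
    qed
    ultimately have "CHAR('a) mod 6 = 5" using char by simp
    moreover have "a = 0" using a char False by simp
    ultimately have "\<not> CARD('a) > 11"
      using not_inj_five_mod_six[OF mod] inj by blast
    moreover have "CARD('a) \<ge> 11" using mod assms(3) by presburger
    ultimately show ?thesis by simp
  qed
qed

lemma inj_sextic_card9_iff:
  fixes f :: "'a :: finite_field poly"
  assumes char: "CHAR('a) = 3" and card: "CARD('a) = 9"
  shows "(\<exists>a b c d e. f = sextic a b c d e) \<and> inj (poly f) \<longleftrightarrow>
    (\<exists>s. s^2 = 2 \<and> (\<exists>a b. a \<noteq> 0 \<and> b \<in> {0, 1, s, 1 + s} \<and>
      f = sextic 0 (a^2) (a^7 * b) (a^4) (a * (2 * b + 1)))) \<or>
    (\<exists>a b. a \<noteq> 0 \<and> f = translated_sextic a b 1 (- 1) (- 1)) \<or>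
    (\<exists>s. s^2 = 2 \<and> (\<exists>a b. \<exists>\<phi> \<in> {1 - s, - (1 - s)}. a \<noteq> 0 \<and> f = translated_sextic a b \<phi> (- \<phi>) s)) \<or>
    (\<exists>s. s^2 = 2 \<and> (\<exists>a b. a \<noteq> 0 \<and> f = translated_sextic a b (- 1) 1 (- 1 + s)))"
    (is "?L \<longleftrightarrow> ?R0 \<or> ?R1 \<or> ?R2 \<or> ?R3")
proof
  note inj_1 = inj_sextic_card9_a_1[OF char card]
  note inj_0 = inj_sextic_card9_a_0[OF char card]
  have pow8: "u ^ 8 = 1" if "u \<noteq> 0" for u :: 'a
    using finite_field_power_minus_1[OF that] by (simp add: card)
  have pow4: "u ^ 4 = 1 \<or> u ^ 4 = - 1" if "u \<noteq> 0" for u :: 'a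
  proof -
    have "(u ^ 4 - 1) * (u ^ 4 + 1) = 0" using pow8[OF that] by algebra
    thus ?thesis by (auto simp: add_eq_0_iff2)
  qed
  {
    assume ?L
    then obtain a b c d e where f: "f = sextic a b c d e" and inj: "inj (poly (sextic a b c d e))" by blast
    show "?R0 \<or> ?R1 \<or> ?R2 \<or> ?R3"
    proof (cases "a = 0")
      case True
      note inj = inj[unfolded True]
      have d: "d = b^2"
      proof -
        have "2 * d + b^2 = 0" using hermite_char3_drop_4[OF char inj, of 0] card by simp
        hence "d = b^2 + 3 * (d - b^2 + b^2)" by algebra
        thus ?thesis by (rule eq_char_3I[OF char])
      qed
      have "b \<noteq> 0" using inj d not_inj_sextic_char3_0[OF char, of c e] card by auto
      have "is_square b" using inj not_inj_sextic_card9_nonsquare[OF char card] unfolding d by blast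
      then obtain u where u: "b = u^2" by (auto simp: is_nth_power_def)
      with \<open>b \<noteq> 0\<close> have "u \<noteq> 0" by auto
      define c' e' where "c' = c / u^3" and "e' = e / u^5"
      have ce: "c = u^3 * c'" "e = u^5 * e'" using \<open>u \<noteq> 0\<close> by (simp_all add: c'_def e'_def)
      have "sextic 0 b c d e = sextic (u * 0) (u^2 * 1) (u^3 * c') (u^4 * 1) (u^5 * e')"
        by (simp add: u d ce)
      with inj have "inj (poly (sextic 0 1 c' 1 e'))"
        by (simp only: inj_sextic_scale[OF \<open>u \<noteq> 0\<close>])
      then obtain r s \<beta> where r: "r \<in> {1, - 1}" and s: "s^2 = 2" "\<beta> \<in> {0, 1, s, 1 + s}"
        and c'e': "c' = r * \<beta>" "e' = r * (2 * \<beta> + 1)"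
        unfolding inj_0 by blast
      \<comment> \<open>a = r u^5 is read off from the coefficient of x; u^8 = 1 and r^2 = 1 make
        the other coefficients fit.\<close>
      define a where "a = r * u^4 * u"
      have r2: "r^2 = 1" using r by auto
      note u8 = pow8[OF \<open>u \<noteq> 0\<close>]
      have "a \<noteq> 0" using r \<open>u \<noteq> 0\<close> by (auto simp: a_def)
      moreover have "a^2 = b" "a^4 = d"
        unfolding a_def u d using r2 u8 by algebra+
      moreover have "a * (2 * \<beta> + 1) = e" unfolding a_def ce c'e' by algebra
      moreover have "a^7 * \<beta> = c"
      proof -
        have "(r^2)^3 * (u^8)^4 * (r * u^3 * \<beta>) = a^7 * \<beta>" unfolding a_def by algebra
        hence "r * u^3 * \<beta> = a^7 * \<beta>" by (simp only: r2 u8 power_one mult_1_left)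
        thus ?thesis by (simp only: ce c'e' mult_ac)
      qed
      ultimately have "a \<noteq> 0 \<and> f = sextic 0 (a^2) (a^7 * \<beta>) (a^4) (a * (2 * \<beta> + 1))"
        by (simp add: f True)
      hence ?R0 using s by blast
      thus ?thesis ..
    next
      case False
      obtain \<beta> c' d' e' where eq: "sextic a b c d e = translated_sextic a \<beta> c' d' e'"
        using sextic_eq_translated_sextic[OF char False] .
      have "inj (poly (sextic 1 0 c' d' e'))"
        using inj unfolding eq inj_translated_sextic[OF char False] .
      hence d': "d' = - c'" and "c' = 1 \<and> e' = - 1 \<or>
         (\<exists>s. s^2 = 2 \<and> (c' \<in> {1 - s, - (1 - s)} \<and> e' = s \<or> c' = - 1 \<and> e' = - 1 + s))"
        unfolding inj_1 by blast+
      then consider "c' = 1" "e' = - 1" | s where "s^2 = 2" "c' \<in> {1 - s, - (1 - s)}" "e' = s"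
        | s where "s^2 = 2" "c' = - 1" "e' = - 1 + s" by blast
      thus ?thesis
      proof cases
        case 1
        with False f eq d' have ?R1 by (intro exI[of _ a] exI[of _ \<beta>]) simp
        thus ?thesis by blast
      next
        case (2 s)
        with False f eq d' have ?R2 by blast
        thus ?thesis by blast
      next
        case (3 s)
        have "f = translated_sextic a \<beta> (- 1) 1 (- 1 + s)" using 3 f eq d' by simp
        with False 3(1) have ?R3 by blast
        thus ?thesis by blast
      qed
    qed
  next
    assume "?R0 \<or> ?R1 \<or> ?R2 \<or> ?R3"
    then consider s a b where "s^2 = 2" "a \<noteq> 0" "b \<in> {0, 1, s, 1 + s}"
        "f = sextic 0 (a^2) (a^7 * b) (a^4) (a * (2 * b + 1))"
      | a b c d e where "a \<noteq> 0" "f = translated_sextic a b c d e" "inj (poly (sextic 1 0 c d e))"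
    proof (elim disjE, goal_cases)
      case 1
      thus ?case by blast
    next
      case 2
      thus ?case using inj_1[of 1 "- 1" "- 1"] by simp blast
    next
      case 3
      then obtain s a b \<phi> where *: "s^2 = 2" "\<phi> \<in> {1 - s, - (1 - s)}" "a \<noteq> 0" "f = translated_sextic a b \<phi> (- \<phi>) s" by blast
      hence "inj (poly (sextic 1 0 \<phi> (- \<phi>) s))" unfolding inj_1 by blast
      with * 3(2) show ?case by blast
    next
      case 4
      then obtain s a b where *: "s^2 = 2" "a \<noteq> 0" "f = translated_sextic a b (- 1) 1 (- 1 + s)" by blast
      hence "inj (poly (sextic 1 0 (- 1) 1 (- 1 + s)))" unfolding inj_1 by force
      with * 4(2) show ?case by blast
    qed
    thus ?L
    proof cases
      case (1 s a b)
      define r where "r = a ^ 4"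
      have r: "r \<in> {1, - 1}" using pow4[OF 1(2)] by (auto simp: r_def)
      have "inj (poly (sextic 0 1 (r * b) 1 (r * (2 * b + 1))))"
        unfolding inj_0 using r 1(1,3) by blast
      moreover have "a * 0 = 0" "a^2 * 1 = a^2" "a^3 * (r * b) = a^7 * b" "a^4 * 1 = a^4"
          "a^5 * (r * (2 * b + 1)) = a * (2 * b + 1)"
        unfolding r_def using pow8[OF 1(2)] by algebra+
      ultimately show ?thesis
        using inj_sextic_scale[OF 1(2), of 0 1 "r * b" 1 "r * (2 * b + 1)"] 1(4) by metis
    next
      case (2 a b c d e)
      thus ?thesis using inj_translated_sextic[OF char 2(1)] unfolding translated_sextic_def by blast
    qed
  }
qed

lemma inj_sextic_card27_iff:
  fixes f :: "'a :: finite_field poly"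
  assumes char: "CHAR('a) = 3" and card: "CARD('a) = 27"
  shows "(\<exists>a b c d e. f = sextic a b c d e) \<and> inj (poly f) \<longleftrightarrow>
    (\<exists>a b. a \<noteq> 0 \<and> f = translated_sextic a b 0 2 0)"
proof
  assume "(\<exists>a b c d e. f = sextic a b c d e) \<and> inj (poly f)"
  then obtain a b c d e where f: "f = sextic a b c d e" and inj: "inj (poly (sextic a b c d e))" by blast
  have "a \<noteq> 0"
    using inj not_inj_sextic_char3_a_0[OF char, of 0 b c d e] card by auto
  obtain \<beta> c' d' e' where eq: "sextic a b c d e = translated_sextic a \<beta> c' d' e'"
    using sextic_eq_translated_sextic[OF char \<open>a \<noteq> 0\<close>] .
  have "inj (poly (sextic 1 0 c' d' e'))"
    using inj unfolding eq inj_translated_sextic[OF char \<open>a \<noteq> 0\<close>] .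
  hence "c' = 0" "d' = 2" "e' = 0" unfolding inj_sextic_card27_a_1[OF char card] by auto
  thus "\<exists>a b. a \<noteq> 0 \<and> f = translated_sextic a b 0 2 0" using \<open>a \<noteq> 0\<close> f eq by blast
next
  assume "\<exists>a b. a \<noteq> 0 \<and> f = translated_sextic a b 0 2 0"
  then obtain a b where ab: "a \<noteq> 0" "f = translated_sextic a b 0 2 0" by blast
  have "inj (poly (sextic 1 0 0 2 (0 :: 'a)))"
    unfolding inj_sextic_card27_a_1[OF char card] by simp
  hence "inj (poly f)" using inj_translated_sextic[OF char ab(1)] ab(2) by blast
  thus "(\<exists>a b c d e. f = sextic a b c d e) \<and> inj (poly f)"
    using ab(2) unfolding translated_sextic_def by blast
qed

lemma translated_sextic_explicit:
  fixes a b s \<phi> :: "'a :: comm_ring_1"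
  assumes "CHAR('a) = 3"
  shows "translated_sextic a b 1 (- 1) (- 1) = [:0, 2 * a^5 + a^4 * b + 2 * a * b^4,
                2 * a^4 + a * b^3, a^3 + a * b^2 + 2 * b^3, 2 * a * b, a, 1:]"
    and "translated_sextic a b \<phi> (- \<phi>) s = [:0, s * a^5 + 2 * a * b^4 + a^4 * b * \<phi>,
                a * b^3 + 2 * a^4 * \<phi>, a * b^2 + 2 * b^3 + a^3 * \<phi>, 2 * a * b, a, 1:]"
    and "translated_sextic a b (- 1) 1 (- 1 + s) = [:0, 2 * a^5 + s * a^5 + 2 * a^4 * b + 2 * a * b^4,
                a^4 + a * b^3, 2 * a^3 + a * b^2 + 2 * b^3, 2 * a * b, a, 1:]"
    and "translated_sextic a b 0 2 0 = [:0, a^4 * b + 2 * a * b^4,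
                2 * a^4 + a * b^3, a * b^2 + 2 * b^3, 2 * a * b, a, 1:]"
  by (simp_all add: translated_sextic_def sextic_def two_eq_minus_1[OF assms] algebra_simps)

theorem mainTheorem3:
  fixes f :: "'a :: finite_field poly" and q :: nat
  assumes "primepow q" and "odd q" and "q \<ge> 7"
    and "CARD('a) = q"
    and "Polynomial.degree f = 6"
  shows
    "(normalised_poly f \<and> permutation_poly f \<longleftrightarrow>
       (q = 11 \<and> (\<exists>e \<in> {1, -1}.
          f = [:0, e * 2, 0, 0, 0, 0, 1:])) \<or>
       (q = 11 \<and> (\<exists>e \<in> {1, -1}.
          f = [:0, e * 4, 0, 0, 0, 0, 1:])) \<or>
       (q = 11 \<and> (\<exists>e \<in> {1, -1}. \<exists>a. a \<noteq> 0 \<and> is_square a \<and>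
          f = [:0, e * 5, a, e * a^2, 0, 0, 1:])) \<or>
       (q = 11 \<and> (\<exists>e \<in> {1, -1}. \<exists>a. \<not> is_square a \<and>
          f = [:0, e * 4, a, e * (4 * a^2), 0, 0, 1:])) \<or>
       (q = 3^2 \<and> (\<exists>s. s^2 = 2 \<and> (\<exists>a b. a \<noteq> 0 \<and> b \<in> {0, 1, s, 1 + s} \<and>
          f = [:0, a * (2 * b + 1), a^4, a^7 * b, a^2, 0, 1:]))) \<or>
       (q = 3^2 \<and> (\<exists>a b. a \<noteq> 0 \<and>
          f = [:0, 2 * a^5 + a^4 * b + 2 * a * b^4,
                2 * a^4 + a * b^3,
                a^3 + a * b^2 + 2 * b^3,
                2 * a * b, a, 1:])) \<or>
       (q = 3^2 \<and> (\<exists>s. s^2 = 2 \<and> (\<exists>a b. \<exists>\<phi> \<in> {1 - s, - (1 - s)}. a \<noteq> 0 \<and>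
          f = [:0, s * a^5 + 2 * a * b^4 + a^4 * b * \<phi>,
                a * b^3 + 2 * a^4 * \<phi>,
                a * b^2 + 2 * b^3 + a^3 * \<phi>,
                2 * a * b, a, 1:]))) \<or>
       (q = 3^2 \<and> (\<exists>s. s^2 = 2 \<and> (\<exists>a b. a \<noteq> 0 \<and>
          f = [:0, 2 * a^5 + s * a^5 + 2 * a^4 * b + 2 * a * b^4,
                a^4 + a * b^3,
                2 * a^3 + a * b^2 + 2 * b^3,
                2 * a * b, a, 1:]))) \<or>
       (q = 3^3 \<and> (\<exists>a b. a \<noteq> 0 \<and>
          f = [:0, a^4 * b + 2 * a * b^4,
                2 * a^4 + a * b^3,
                a * b^2 + 2 * b^3,
                2 * a * b, a, 1:]))) \<and>
     (normalised_poly f \<and> permutation_poly f \<longrightarrow> q \<in> {9, 11, 27})"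
proof -
  let ?PP = "normalised_poly f \<and> permutation_poly f"
  obtain p k where pk: "prime p" "k > 0" "q = p ^ k" using assms(1) by (auto simp: primepow_def)
  have "CHAR('a) = p" using CHAR_eq_prime_base[of p k] assms(4) pk by simp
  hence "CHAR('a) \<noteq> 2" using assms(2) pk by auto
  note pp = normalised_poly_iff_sextic[OF assms(5) this] permutation_poly_iff_inj[of f]
  have q: "q = 9 \<and> CHAR('a) = 3 \<or> q = 27 \<and> CHAR('a) = 3 \<or> q = 11" if ?PP
  proof -
    from that obtain a b c d e where "f = sextic a b c d e" "CHAR('a) = 3 \<or> a = 0" "inj (poly f)"
      unfolding pp by blast
    thus ?thesis using inj_sextic_imp_card[of a b c d e] assms by simp
  qed
  consider "q = 9" | "q = 11" | "q = 27" | "q \<notin> {9, 11, 27}" by blast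
  thus ?thesis
  proof cases
    case 1
    have char: "CHAR('a) = 3"
      using CHAR_eq_prime_base[where 'a = 'a, of 3 2] 1 assms(4) by simp
    have "CARD('a) = 9" using 1 assms(4) by simp
    note iff9 = inj_sextic_card9_iff[OF char this, of f]
    have S: "sextic 0 (a^2) (a^7 * b) (a^4) (a * (2 * b + 1)) = [:0, a * (2 * b + 1), a^4, a^7 * b, a^2, 0, 1:]"
      for a b :: 'a by (simp only: sextic_def)
    have "?PP \<longleftrightarrow> (\<exists>a b c d e. f = sextic a b c d e) \<and> inj (poly f)"
      unfolding pp using char by blast
    \<comment> \<open>The equation with literal constants is unfolded separately: the general one
      with \<phi> also matches \<phi> = 1, s = - 1 and would produce another form.\<close>
    note iff = trans[OF this iff9[unfolded translated_sextic_explicit(1)[OF char],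
        unfolded translated_sextic_explicit(2-4)[OF char] S]]
    have "(q = 11) = False" "(q = 3^2) = True" "(q = 3^3) = False" "(q \<in> {9, 11, 27}) = True"
      using 1 by simp_all
    thus ?thesis by (simp only: simp_thms) (rule iff)
  next
    case 2
    have "CHAR('a) = 11" using CHAR_eq_prime_base[where 'a = 'a, of 11 1] 2 assms(4) by simp
    hence "?PP \<longleftrightarrow> (\<exists>a b c d. f = sextic 0 a b c d \<and> inj (poly (sextic 0 a b c d)))"
      unfolding pp by auto
    also have "\<dots> \<longleftrightarrow> (\<exists>a b c d. f = sextic 0 a b c d \<and> a = 0 \<and> (\<exists>r \<in> {1, - 1}.
        b = 0 \<and> c = 0 \<and> d \<in> {r * 2, r * 4} \<or>
        c \<noteq> 0 \<and> is_square c \<and> b = r * c^2 \<and> d = r * 5 \<or>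
        \<not> is_square c \<and> b = r * (4 * c^2) \<and> d = r * 4))"
      using inj_sextic_card11[where 'a = 'a] 2 assms(4) by simp
    also have "\<dots> \<longleftrightarrow> (\<exists>r \<in> {1, - 1}. f = [:0, r * 2, 0, 0, 0, 0, 1:]) \<or>
        (\<exists>r \<in> {1, - 1}. f = [:0, r * 4, 0, 0, 0, 0, 1:]) \<or>
        (\<exists>r \<in> {1, - 1}. \<exists>c. c \<noteq> 0 \<and> is_square c \<and> f = [:0, r * 5, c, r * c^2, 0, 0, 1:]) \<or>
        (\<exists>r \<in> {1, - 1}. \<exists>c. \<not> is_square c \<and> f = [:0, r * 4, c, r * (4 * c^2), 0, 0, 1:])"
      unfolding sextic_def by blast
    finally show ?thesis using 2 by simp
  next
    case 3
    have char: "CHAR('a) = 3"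
      using CHAR_eq_prime_base[where 'a = 'a, of 3 3] 3 assms(4) by simp
    have "?PP \<longleftrightarrow> (\<exists>a b c d e. f = sextic a b c d e) \<and> inj (poly f)"
      unfolding pp using char by blast
    thus ?thesis
      using assms(4) 3 inj_sextic_card27_iff[OF char, of f]
      unfolding translated_sextic_explicit[OF char] by simp
  next
    case 4
    thus ?thesis using q by auto
  qed
qed

end
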